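(* Let $1<\alpha<2$, $\gamma>0$, $\tau>0$, $\mathrm{a}<\mathrm{b}$, let $M\ge 8$ be even, $h=(\mathrm{b}-\mathrm{a})/(M+1)$, $\mu=\gamma\tau/h^\alpha$, let $D\in\mathbb{R}^{M\times M}$ be diagonal with nonpositive diagonal entries, and let $\omega>0$. Let $\theta,\theta_0$ be as in the context and $$\xi=\frac{2M^{1/2}\sqrt{1+\left\{\omega+2\left[\frac{\Gamma(\alpha+1)\mu}{\Gamma(\alpha/2+1)^2}-\frac{\theta\gamma\tau}{(\mathrm{b}-\mathrm{a})^\alpha}\right]\right\}^2}}{\sqrt{1+\left[\omega+\frac{2^{\alpha+1}\gamma\tau\theta}{(\mathrm{b}-\mathrm{a})^\alpha}\right]^2}\;\sqrt{1+\left[\omega+\frac{2\gamma\tau\theta}{(\mathrm{b}-\mathrm{a})^\alpha}\right]^2}}.$$ Let $\epsilon$ satisfy $2^\alpha\mu\theta_0/(M-2)^\alpha<\epsilon\le\mu\theta_0$ and $k_0=\lceil(\mu\theta_0/\epsilon)^{1/\alpha}\rceil+1$. Then there exist $\mathcal{M}_\omega,\mathcal{N}_\omega\in\mathbb{R}^{2M\times 2M}$ with $\mathrm{rank}(\mathcal{M}_\omega)=4k_0$, $\|\mathcal{M}_\omega\|_2\le\mu\xi\left[\frac{c_0}{2}-\frac{\theta}{(M-1/2)^\alpha}\right]$ and $\|\mathcal{N}_\omega\|_2\le\xi\epsilon$, such that $$\widetilde{\mathcal{F}}_\omega^{-1}\mathcal{R}=\mathcal{F}_\omega^{-1}\mathcal{R}+\mathcal{M}_\omega+\mathcal{N}_\omega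 .$$
   Context: $\theta=\frac{\left(1-\frac{1+\alpha}{5+\alpha/2}\right)^{5+\alpha/2}e^{1+\alpha}\Gamma(\alpha+1)\sin(\pi\alpha/2)}{\pi\alpha}$ and $\theta_0=\frac{\sqrt2\,e^{13/12}\Gamma(1+\alpha)\sin(\pi\alpha/2)}{\pi\alpha}$. For $k\in\mathbb{Z}$, $c_k=(-1)^k\Gamma(\alpha+1)/[\Gamma(\alpha/2-k+1)\Gamma(\alpha/2+k+1)]$ ($\Gamma$ the gamma function, $1/\Gamma=0$ at poles); in particular $c_0=\Gamma(\alpha+1)/\Gamma(\alpha/2+1)^2$. $T\in\mathbb{R}^{M\times M}$ is the symmetric Toeplitz matrix with entries $T_{jk}=\mu c_{j-k}$. For even $M$, $C\in\mathbb{R}^{M\times M}$ is Strang's circulant approximation of $T$: the symmetric circulant matrix whose first row is $\mu(c_0,c_1,\dots,c_{M/2-1},0,c_{M/2-1},\dots,c_1)$, each subsequent row being the cyclic right shift of the previous one. With $I$ the identity of the appropriate size, define $$\mathcal{R}=\begin{bmatrix}T-D & -I\\ I & T-D\end{bmatrix},\quad \mathcal{B}=\begin{bmatrix}-D&0\\0&-D\end{bmatrix},\quad \mathcal{H}=\begin{bmatrix}T&-I\\ I&T\end{bmatrix},\quad \mathcal{C}=\begin{bmatrix}C&-I\\ I&C\end{bmatrix},$$ $$\mathcal{F}_\omega=\tfrac{1}{2\omega}(\omega I+\mathcal{B})(\omega I+\mathcal{H}),\qquad \widetilde{\mathcal{F}}_\omega=\tfrac{1}{2\omega}(\omega I+\mathcal{B})(\omega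 I+\mathcal{C}).$$ $\|\cdot\|_2$ is the spectral norm. *)

theory Defs
  imports "HOL-Analysis.Analysis"
begin

text \<open>Coefficients c_k, with 1/Gamma = rGamma (zero at the poles).\<close>
definition cc :: "real \<Rightarrow> int \<Rightarrow> real" where
  "cc \<alpha> k = (-1) powi k * Gamma (\<alpha> + 1) * rGamma (\<alpha>/2 - of_int k + 1) * rGamma (\<alpha>/2 + of_int k + 1)"

text \<open>Matrix indices of type 'n are identified with 0..M-1 via a bijection ix.\<close>
definition toeplitzT :: "real \<Rightarrow> real \<Rightarrow> ('n::finite \<Rightarrow> nat) \<Rightarrow> real^'n^'n" where
  "toeplitzT \<alpha> \<mu> ix = (\<chi> i j. \<mu> * cc \<alpha> (int (ix i) - int (ix j)))"

text \<open>Strang circulant: entry (i,j) is the first-row entry at position (j - i) mod M.\<close>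
definition strangC :: "real \<Rightarrow> real \<Rightarrow> nat \<Rightarrow> ('n::finite \<Rightarrow> nat) \<Rightarrow> real^'n^'n" where
  "strangC \<alpha> \<mu> M ix = (\<chi> i j.
     (let d = (int (ix j) - int (ix i)) mod int M in
      if 2 * d < int M then \<mu> * cc \<alpha> d
      else if 2 * d = int M then 0
      else \<mu> * cc \<alpha> (int M - d)))"

definition blk :: "real^'n^'n \<Rightarrow> real^'n^'n \<Rightarrow> real^'n^'n \<Rightarrow> real^'n^'n \<Rightarrow> real^('n::finite + 'n)^('n + 'n)" where
  "blk A B C E = (\<chi> p q. case p of
      Inl i \<Rightarrow> (case q of Inl j \<Rightarrow> A $ i $ j | Inr j \<Rightarrow> B $ i $ j)
    | Inr i \<Rightarrow> (case q of Inl j \<Rightarrow> C $ i $ j | Inr j \<Rightarrow> E $ i $ j))"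

definition specnorm :: "real^'m^'n \<Rightarrow> real" where
  "specnorm A = onorm (\<lambda>x. A *v x)"

end

theory Submission
  imports Defs
begin

text \<open>
  Since \<open>\<R> = \<B> + \<H>\<close>, the two preconditioned matrices differ by
  \<open>(\<omega>I + \<C>)\<^sup>-\<^sup>1 (\<H> - \<C>) F\<^sup>-\<^sup>1\<R>\<close>, and \<open>\<H> - \<C>\<close> is block diagonal with blocks \<open>T - C\<close>.
  The matrix \<open>T - C\<close> lives in the two corners \<open>\<bar>i - j\<bar> \<ge> M/2\<close>; its entries with
  \<open>\<bar>i - j\<bar> \<ge> M - k\<^sub>0\<close> form two triangular blocks of size \<open>k\<^sub>0\<close> with nonzero diagonal, which gives
  the rank, while the remaining entries have row sums at most \<open>\<epsilon>\<close>.
  For the factor \<open>F\<^sup>-\<^sup>1\<R>\<close> one writes \<open>2\<omega>\<R> = (\<omega>I + \<B>)(\<omega>I + \<H>) - (\<omega>I - \<B>)(\<omega>I - \<H>)\<close> and uses that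
  the diagonal Cayley transform of \<open>\<B>\<close> is a contraction.
  All spectral bounds come from diagonal dominance: the \<open>c\<^sub>k\<close> telescope, so their tail sums are
  Gamma quotients \<open>\<Gamma>(n - \<alpha>/2) / \<Gamma>(n + \<alpha>/2)\<close>, which log-convexity of \<open>\<Gamma>\<close> places between
  \<open>n\<^sup>-\<^sup>\<alpha>\<close> and \<open>(n - 1)\<^sup>-\<^sup>\<alpha>\<close>.
\<close>

section \<open>Tail sums of the coefficients\<close>

text \<open>The chord inequality with denominators cleared: \<open>y\<close> is the mean of
  \<open>x\<close> and \<open>z\<close> with weight (y - x)/(z - x). In this form every bound on ln
  Gamma below follows by linear arithmetic.\<close>

lemma convex_on_slopes:
  fixes f :: "real \<Rightarrow> real"
  assumes "convex_on S f" "x \<in> S" "z \<in> S" "x < y" "y < z"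
  shows "(z - x) * f y \<le> (z - y) * f x + (y - x) * f z"
proof -
  define u where "u = (y - x) / (z - x)"
  have u: "0 \<le> u" "u \<le> 1" "u * (z - x) = y - x" using assms by (auto simp: u_def)
  have y: "(1 - u) * x + u * z = y" using u(3) by (simp add: algebra_simps)
  have "f y \<le> (1 - u) * f x + u * f z"
    using convex_onD[OF assms(1) u(1,2) assms(2,3)] by (simp add: y)
  then have "(z - x) * f y \<le> (z - x) * ((1 - u) * f x + u * f z)"
    using assms by (intro mult_left_mono) auto
  also have "\<dots> = (z - x - u * (z - x)) * f x + (u * (z - x)) * f z"
    by (simp add: algebra_simps)
  also have "\<dots> = (z - y) * f x + (y - x) * f z" by (simp add: u(3))
  finally show ?thesis .
qed

lemma ln_Gamma_plus1:
  assumes "x > (0::real)"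
  shows "ln (Gamma (x + 1)) = ln x + ln (Gamma x)"
proof -
  have "x \<notin> \<int>\<^sub>\<le>\<^sub>0" using assms by (auto elim!: nonpos_Ints_cases)
  then show ?thesis using assms Gamma_real_pos[OF assms] by (simp add: Gamma_plus1 ln_mult_pos)
qed

text \<open>ln Gamma increases by ln x over [x, x+1]. By convexity it grows by at most s ln x from x
  to x+s, and drops by at most s ln x from x to x-s.\<close>

lemma Gamma_quotient_lower:
  fixes x s :: real
  assumes "x \<ge> 1" "0 < s" "s < 1"
  shows "x powr (- (2 * s)) \<le> Gamma (x - s) / Gamma (x + s)"
proof -
  define L where "L = (\<lambda>u::real. ln (Gamma u))"
  have cv: "convex_on {0<..} L"
    using log_convex_Gamma_real by (simp add: L_def o_def)
  have L1: "L (x + 1) = ln x + L x"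
    using assms by (simp add: L_def ln_Gamma_plus1)
  have a: "L (x + s) \<le> L x + s * ln x"
    using convex_on_slopes[OF cv, of x "x + 1" "x + s"] assms L1 by (simp add: algebra_simps)
  have b: "L (x - s) \<ge> L x - s * ln x"
    using convex_on_slopes[OF cv, of "x - s" "x + 1" x] assms L1 by (simp add: algebra_simps)
  have pos: "Gamma (x - s) > 0" "Gamma (x + s) > 0" using assms by (auto intro!: Gamma_real_pos)
  have "x powr (- (2 * s)) = exp (- (2 * s) * ln x)" using assms by (simp add: powr_def)
  also have "\<dots> \<le> exp (L (x - s) - L (x + s))" using a b by simp
  also have "\<dots> = Gamma (x - s) / Gamma (x + s)" using pos by (simp add: L_def exp_diff)
  finally show ?thesis .
qed

text \<open>The same comparison with the unit interval to the left of x, where the slope is ln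
  (x-1). This is why the upper bound carries x - 1 in place of x.\<close>

lemma Gamma_quotient_upper:
  fixes x s :: real
  assumes "x > 1" "0 < s" "s < 1"
  shows "Gamma (x - s) / Gamma (x + s) \<le> (x - 1) powr (- (2 * s))"
proof -
  define L where "L = (\<lambda>u::real. ln (Gamma u))"
  have cv: "convex_on {0<..} L"
    using log_convex_Gamma_real by (simp add: L_def o_def)
  have L1: "L x = ln (x - 1) + L (x - 1)"
    using assms ln_Gamma_plus1[of "x - 1"] by (simp add: L_def)
  have a: "L (x - s) \<le> L x - s * ln (x - 1)"
    using convex_on_slopes[OF cv, of "x - 1" x "x - s"] assms L1 by (simp add: algebra_simps)
  have b: "L (x + s) \<ge> L x + s * ln (x - 1)"
    using convex_on_slopes[OF cv, of "x - 1" "x + s" x] assms L1 by (simp add: algebra_simps)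
  have pos: "Gamma (x - s) > 0" "Gamma (x + s) > 0" using assms by (auto intro!: Gamma_real_pos)
  have "Gamma (x - s) / Gamma (x + s) = exp (L (x - s) - L (x + s))" using pos by (simp add: L_def exp_diff)
  also have "\<dots> \<le> exp (- (2 * s) * ln (x - 1))" using a b by simp
  also have "\<dots> = (x - 1) powr (- (2 * s))" using assms by (simp add: powr_def)
  finally show ?thesis .
qed

text \<open>Closed form of the tail \<open>\<Sum>k\<ge>n. \<bar>c\<^sub>k\<bar>\<close>: the quotients \<open>\<Gamma>(k - \<alpha>/2) / \<Gamma>(k + \<alpha>/2)\<close> telescope.\<close>
definition cc_tail :: "real \<Rightarrow> nat \<Rightarrow> real" where
  "cc_tail \<alpha> n = Gamma (\<alpha> + 1) * sin (pi * \<alpha> / 2) / (pi * \<alpha>)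
     * (Gamma (real n - \<alpha>/2) / Gamma (real n + \<alpha>/2))"

section \<open>The coefficients as Gamma quotients: signs, monotonicity and telescoping sums\<close>

lemma cc_minus: "cc \<alpha> (- k) = cc \<alpha> k"
  by (simp add: cc_def power_int_minus mult_ac flip: power_int_inverse)

lemma rGamma_reflection_real:
  fixes x :: real
  shows "rGamma x * rGamma (1 - x) = sin (pi * x) / pi"
proof -
  have "complex_of_real (rGamma x * rGamma (1 - x)) = of_real (sin (pi * x) / pi)"
    using rGamma_reflection_complex[of "of_real x"]
    by (simp flip: rGamma_complex_of_real sin_of_real)
  then show ?thesis by (simp only: of_real_eq_iff)
qed

text \<open>Reflection replaces the reciprocal Gamma value at \<alpha>/2 - m + 1, whose argument may
  be negative, by Gamma (m - \<alpha>/2) times a sine. The sign (-1)^m produced by that sine cancels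
  the one in \<open>cc\<close>.\<close>

lemma cc_eq:
  fixes m :: nat
  assumes "0 < \<alpha>" "\<alpha> < 2" "m \<ge> 1"
  shows "cc \<alpha> (int m) = - (Gamma (\<alpha> + 1) * sin (pi * \<alpha> / 2) / pi
           * (Gamma (real m - \<alpha>/2) / Gamma (real m + \<alpha>/2 + 1)))"
proof -
  define s where "s = \<alpha> / 2"
  have G: "Gamma (real m - s) > 0" using assms by (intro Gamma_real_pos) (auto simp: s_def)
  have "rGamma (real m - s) * rGamma (1 - (real m - s)) = sin (pi * (real m - s)) / pi"
    by (rule rGamma_reflection_real)
  also have "sin (pi * (real m - s)) = - ((-1) ^ m * sin (pi * s))"
    by (simp add: right_diff_distrib sin_diff)
  finally have "rGamma (s - real m + 1) = - ((-1) ^ m * sin (pi * s)) / pi * Gamma (real m - s)"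
    using G by (simp add: rGamma_inverse_Gamma[of "real m - s"] field_simps)
  moreover have "cc \<alpha> (int m) = (-1) ^ m * Gamma (\<alpha> + 1) * rGamma (s - real m + 1) * rGamma (s + real m + 1)"
    by (simp add: cc_def s_def)
  ultimately have "cc \<alpha> (int m) = ((-1) ^ m * (-1) ^ m) *
      - (Gamma (\<alpha> + 1) * sin (pi * s) / pi * (Gamma (real m - s) * rGamma (s + real m + 1)))"
    by simp
  also have "(-1) ^ m * (-1) ^ m = (1::real)" by (simp flip: power_mult_distrib)
  finally show ?thesis
    by (simp add: s_def rGamma_inverse_Gamma add_ac flip: divide_inverse)
qed

text \<open>Write s = \<alpha>/2 and q(m) = Gamma (m-s) / Gamma (m+s). The functional equation gives
  q(m+1) = q(m) (m-s)/(m+s), so the difference q(m) - q(m+1) has numerator factor 2s = \<alpha>,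
  which cancels the \<alpha> in the denominator of \<open>cc_tail\<close>.\<close>

lemma cc_eq_tail_diff:
  assumes "0 < \<alpha>" "\<alpha> < 2" "m \<ge> 1"
  shows "- cc \<alpha> (int m) = cc_tail \<alpha> m - cc_tail \<alpha> (Suc m)"
proof -
  define s where "s = \<alpha> / 2"
  have \<alpha>: "\<alpha> = 2 * s" by (simp add: s_def)
  have p: "real m - s > 0" "real m + s > 0" using assms by (auto simp: s_def)
  then have n: "real m - s \<notin> \<int>\<^sub>\<le>\<^sub>0" "real m + s \<notin> \<int>\<^sub>\<le>\<^sub>0" by (auto elim!: nonpos_Ints_cases)
  have g: "Gamma (real m + s) > 0" using p by (auto intro!: Gamma_real_pos)
  have e: "real (Suc m) - s = real m - s + 1" "real (Suc m) + s = real m + s + 1" by auto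
  have "Gamma (real m - s) / Gamma (real m + s) - Gamma (real (Suc m) - s) / Gamma (real (Suc m) + s)
     = \<alpha> * (Gamma (real m - s) / Gamma (real m + s + 1))"
    unfolding e Gamma_plus1[OF n(1)] Gamma_plus1[OF n(2)]
    unfolding \<alpha> using p g by (simp add: divide_simps) (simp add: algebra_simps)
  then show ?thesis using assms
    unfolding cc_tail_def cc_eq[OF assms] s_def right_diff_distrib[symmetric]
    by simp
qed

text \<open>Reflection at s = \<alpha>/2 rewrites Gamma (1-s) sin (pi s) as pi / Gamma s. Since
  \<open>cc_tail \<alpha> 1\<close> bounds the moduli on one side of the diagonal, a truncated row
  is diagonally dominant with a margin that is again a tail.\<close>

lemma cc_0_eq_tail:
  assumes "0 < \<alpha>" "\<alpha> < 2"
  shows "cc \<alpha> 0 = 2 * cc_tail \<alpha> 1"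
proof -
  define s where "s = \<alpha> / 2"
  have \<alpha>: "\<alpha> = 2 * s" by (simp add: s_def)
  have s: "0 < s" "s < 1" using assms by (auto simp: s_def)
  have n: "s \<notin> \<int>\<^sub>\<le>\<^sub>0" using s by (auto elim!: nonpos_Ints_cases)
  have G: "Gamma s > 0" "Gamma (1 - s) > 0" using s by auto
  have "rGamma s * rGamma (1 - s) = sin (pi * s) / pi"
  by (rule rGamma_reflection_real)
  then have "Gamma (1 - s) * sin (pi * s) = pi / Gamma s"
    using G by (simp add: rGamma_inverse_Gamma field_simps)
  moreover have "Gamma (s + 1) = s * Gamma s" by (rule Gamma_plus1[OF n])
  ultimately show ?thesis
    unfolding cc_def cc_tail_def rGamma_inverse_Gamma \<alpha>
    using s G by (simp add: divide_simps add.commute mult.left_commute)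
qed

lemma cc_0: "cc \<alpha> 0 = Gamma (\<alpha> + 1) / Gamma (\<alpha>/2 + 1)^2"
  by (simp add: cc_def rGamma_inverse_Gamma field_simps power2_eq_square)

lemma sum_cc:
  assumes "0 < \<alpha>" "\<alpha> < 2" "1 \<le> p" "p \<le> q"
  shows "(\<Sum>m=p..<q. - cc \<alpha> (int m)) = cc_tail \<alpha> p - cc_tail \<alpha> q"
proof -
  have "(\<Sum>m=p..<q. - cc \<alpha> (int m)) = (\<Sum>m=p..<q. cc_tail \<alpha> m - cc_tail \<alpha> (Suc m))"
    using assms by (intro sum.cong) (auto simp: cc_eq_tail_diff)
  then show ?thesis using assms sum_Suc_diff'[of p q "cc_tail \<alpha>"]
    by (simp add: sum_subtractf)
qed

lemma sin_pi_half_pos: "0 < \<alpha> \<Longrightarrow> \<alpha> < 2 \<Longrightarrow> sin (pi * \<alpha> / 2) > 0"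
  by (rule sin_gt_zero) auto

lemma cc_neg:
  assumes "0 < \<alpha>" "\<alpha> < 2" "m \<ge> 1"
  shows "cc \<alpha> (int m) < 0"
  unfolding cc_eq[OF assms] using assms
  by (auto intro!: divide_pos_pos mult_pos_pos Gamma_real_pos sin_pi_half_pos)

text \<open>The ratio of consecutive coefficients is (m-s)/(m+s+1) with s = \<alpha>/2. It is below
  1 and the coefficients are negative, so they increase.\<close>

lemma cc_Suc_gt:
  assumes "0 < \<alpha>" "\<alpha> < 2" "m \<ge> 1"
  shows "cc \<alpha> (int m) < cc \<alpha> (int (Suc m))"
proof -
  define s where "s = \<alpha> / 2"
  have p: "real m - s > 0" "real m + s + 1 > 0" using assms by (auto simp: s_def)
  then have n: "real m - s \<notin> \<int>\<^sub>\<le>\<^sub>0" "real m + s + 1 \<notin> \<int>\<^sub>\<le>\<^sub>0" by (auto elim!: nonpos_Ints_cases)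
  have e: "real (Suc m) - s = real m - s + 1" "real (Suc m) + s + 1 = real m + s + 1 + 1" by auto
  have "cc \<alpha> (int (Suc m)) = cc \<alpha> (int m) * ((real m - s) / (real m + s + 1))"
    using assms unfolding cc_eq[OF assms(1,2,3)] cc_eq[OF assms(1,2) le_SucI[OF assms(3)]]
      s_def[symmetric] e Gamma_plus1[OF n(1)] Gamma_plus1[OF n(2)] by (simp add: mult_ac)
  moreover have "(real m - s) / (real m + s + 1) < 1" using p assms by (simp add: s_def)
  ultimately show ?thesis using cc_neg[OF assms] by (metis mult_less_cancel_left_neg mult.right_neutral)
qed

lemma cc_strict_mono:
  assumes "0 < \<alpha>" "\<alpha> < 2" "m \<ge> 1" "m < n"
  shows "cc \<alpha> (int m) < cc \<alpha> (int n)"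
  using assms(4,3)
proof (induction rule: less_Suc_induct)
  case (1 i) then show ?case using cc_Suc_gt[OF assms(1,2)] by simp
qed auto

lemma cc_tail_lower:
  assumes "0 < \<alpha>" "\<alpha> < 2" "n \<ge> 1"
  shows "Gamma (\<alpha> + 1) * sin (pi * \<alpha> / 2) / (pi * \<alpha>) / real n powr \<alpha> \<le> cc_tail \<alpha> n"
proof -
  have "real n powr - \<alpha> \<le> Gamma (real n - \<alpha>/2) / Gamma (real n + \<alpha>/2)"
    using Gamma_quotient_lower[of "real n" "\<alpha>/2"] assms by simp
  then have "Gamma (\<alpha> + 1) * sin (pi * \<alpha> / 2) / (pi * \<alpha>) * real n powr - \<alpha> \<le> cc_tail \<alpha> n"
    unfolding cc_tail_def using assms sin_pi_half_pos[of \<alpha>] by (intro mult_left_mono) auto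
  then show ?thesis by (simp add: powr_minus_divide)
qed

text \<open>The index n+1 on the left absorbs the shift by one in the upper bound for the Gamma
  quotient.\<close>

lemma cc_tail_upper:
  assumes "0 < \<alpha>" "\<alpha> < 2" "n \<ge> 1"
  shows "cc_tail \<alpha> (Suc n) \<le> Gamma (\<alpha> + 1) * sin (pi * \<alpha> / 2) / (pi * \<alpha>) / real n powr \<alpha>"
proof -
  have "Gamma (real (Suc n) - \<alpha>/2) / Gamma (real (Suc n) + \<alpha>/2) \<le> real n powr - \<alpha>"
    using Gamma_quotient_upper[of "real (Suc n)" "\<alpha>/2"] assms by simp
  then have "cc_tail \<alpha> (Suc n) \<le> Gamma (\<alpha> + 1) * sin (pi * \<alpha> / 2) / (pi * \<alpha>) * real n powr - \<alpha>"
    unfolding cc_tail_def using assms sin_pi_half_pos[of \<alpha>] by (intro mult_left_mono) auto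
  then show ?thesis by (simp add: powr_minus_divide)
qed

section \<open>Norms and ranks of block matrices\<close>

text \<open>Schur's test: Cauchy-Schwarz in each row brings in the row sums, and summation over the
  rows brings in the column sums. By symmetry both are bounded by \<open>r\<close>.\<close>

lemma norm_mult_vec_row_sum_le:
  fixes A :: "real^'n^'n"
  assumes sym: "\<And>i j. A $ i $ j = A $ j $ i"
    and row: "\<And>i. (\<Sum>j\<in>UNIV. \<bar>A $ i $ j\<bar>) \<le> r"
  shows "norm (A *v x) \<le> r * norm x"
proof -
  have r0: "0 \<le> r" using row[of undefined] by (meson abs_ge_zero order_trans sum_nonneg)
  have "((A *v x) $ i)\<^sup>2 \<le> r * (\<Sum>j\<in>UNIV. \<bar>A $ i $ j\<bar> * (x $ j)\<^sup>2)" for i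
  proof -
    have "\<bar>(A *v x) $ i\<bar> \<le> (\<Sum>j\<in>UNIV. \<bar>A $ i $ j * x $ j\<bar>)"
      by (simp add: matrix_vector_mult_def sum_abs)
    \<comment> \<open>Half of each weight goes to either factor, so that Cauchy-Schwarz leaves a
      plain row sum and a weighted sum of squares.\<close>
    also have "\<dots> = (\<Sum>j\<in>UNIV. sqrt \<bar>A $ i $ j\<bar> * (sqrt \<bar>A $ i $ j\<bar> * \<bar>x $ j\<bar>))"
      by (simp add: abs_mult mult.assoc[symmetric])
    finally have "\<bar>(A *v x) $ i\<bar> \<le> (\<Sum>j\<in>UNIV. sqrt \<bar>A $ i $ j\<bar> * (sqrt \<bar>A $ i $ j\<bar> * \<bar>x $ j\<bar>))" .
    from power_mono[OF this abs_ge_zero, of 2]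
    have "((A *v x) $ i)\<^sup>2 \<le> (\<Sum>j\<in>UNIV. sqrt \<bar>A $ i $ j\<bar> * (sqrt \<bar>A $ i $ j\<bar> * \<bar>x $ j\<bar>))\<^sup>2"
      by simp
    also have "\<dots> \<le> (\<Sum>j\<in>UNIV. (sqrt \<bar>A $ i $ j\<bar>)\<^sup>2) * (\<Sum>j\<in>UNIV. (sqrt \<bar>A $ i $ j\<bar> * \<bar>x $ j\<bar>)\<^sup>2)"
      by (rule Cauchy_Schwarz_ineq_sum)
    also have "\<dots> = (\<Sum>j\<in>UNIV. \<bar>A $ i $ j\<bar>) * (\<Sum>j\<in>UNIV. \<bar>A $ i $ j\<bar> * (x $ j)\<^sup>2)"
      by (simp add: power_mult_distrib)
    also have "\<dots> \<le> r * (\<Sum>j\<in>UNIV. \<bar>A $ i $ j\<bar> * (x $ j)\<^sup>2)"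
      by (intro mult_right_mono row sum_nonneg) auto
    finally show ?thesis .
  qed
  then have "(\<Sum>i\<in>UNIV. ((A *v x) $ i)\<^sup>2) \<le> (\<Sum>i\<in>UNIV. r * (\<Sum>j\<in>UNIV. \<bar>A $ i $ j\<bar> * (x $ j)\<^sup>2))"
    by (intro sum_mono)
  also have "\<dots> = r * (\<Sum>i\<in>UNIV. \<Sum>j\<in>UNIV. \<bar>A $ i $ j\<bar> * (x $ j)\<^sup>2)"
    by (simp add: sum_distrib_left)
  also have "\<dots> = r * (\<Sum>j\<in>UNIV. \<Sum>i\<in>UNIV. \<bar>A $ i $ j\<bar> * (x $ j)\<^sup>2)"
    by (subst sum.swap) simp
  also have "\<dots> = r * (\<Sum>j\<in>UNIV. (\<Sum>i\<in>UNIV. \<bar>A $ j $ i\<bar>) * (x $ j)\<^sup>2)"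
    by (simp add: sum_distrib_right sym)
  also have "\<dots> \<le> r * (\<Sum>j\<in>UNIV. r * (x $ j)\<^sup>2)"
    by (intro mult_left_mono sum_mono mult_right_mono row r0) auto
  also have "\<dots> = r\<^sup>2 * (\<Sum>j\<in>UNIV. (x $ j)\<^sup>2)"
    by (simp add: sum_distrib_left[symmetric] power2_eq_square)
  finally have "(norm (A *v x))\<^sup>2 \<le> (r * norm x)\<^sup>2"
    by (simp add: norm_vec_def L2_set_def sum_nonneg power_mult_distrib)
  then show ?thesis
    by (rule power2_le_imp_le) (use r0 in auto)
qed

text \<open>A norm version of Gershgorin's theorem: Schur's test for the matrix with its constant
  diagonal removed. As a distance from a multiple of the identity it yields upper and lower bounds
  alike.\<close>

lemma norm_mult_vec_minus_diag_le:
  fixes A :: "real^'n^'n"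
  assumes "\<And>i j. A $ i $ j = A $ j $ i" "\<And>i. A $ i $ i = d"
    and row: "\<And>i. (\<Sum>j\<in>UNIV - {i}. \<bar>A $ i $ j\<bar>) \<le> r"
  shows "norm (A *v x - d *\<^sub>R x) \<le> r * norm x"
proof -
  have "(\<Sum>j\<in>UNIV. \<bar>(A - d *\<^sub>R mat 1) $ i $ j\<bar>) \<le> r" for i
  proof -
    have "(\<Sum>j\<in>UNIV. \<bar>(A - d *\<^sub>R mat 1) $ i $ j\<bar>) = (\<Sum>j\<in>UNIV - {i}. \<bar>(A - d *\<^sub>R mat 1) $ i $ j\<bar>)"
      by (rule sum.mono_neutral_right) (auto simp: mat_def assms)
    also have "\<dots> = (\<Sum>j\<in>UNIV - {i}. \<bar>A $ i $ j\<bar>)" by (intro sum.cong) (auto simp: mat_def)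
    finally show ?thesis using row by simp
  qed
  moreover have "(A - d *\<^sub>R mat 1) $ i $ j = (A - d *\<^sub>R mat 1) $ j $ i" for i j
    using assms(1)[of i j] by (simp add: mat_def)
  moreover have "(A - d *\<^sub>R mat 1) *v x = A *v x - d *\<^sub>R x"
    by (simp add: matrix_vector_mult_diff_rdistrib scaleR_matrix_vector_assoc[symmetric])
  ultimately show ?thesis using norm_mult_vec_row_sum_le[of "A - d *\<^sub>R mat 1" r x] by simp
qed

section \<open>Block matrices acting on the two halves of a vector\<close>

definition vfst :: "real^('n::finite + 'n) \<Rightarrow> real^'n" where "vfst z = (\<chi> i. z $ Inl i)"
definition vsnd :: "real^('n::finite + 'n) \<Rightarrow> real^'n" where "vsnd z = (\<chi> i. z $ Inr i)"

lemma sum_UNIV_Plus: "(\<Sum>p\<in>(UNIV::('a::finite + 'b::finite) set). f p) = (\<Sum>i\<in>UNIV. f (Inl i)) + (\<Sum>i\<in>UNIV. f (Inr i))"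
  by (subst UNIV_Plus_UNIV[symmetric], subst sum.Plus) auto

lemma vec_sum_eq_iff: "z = w \<longleftrightarrow> vfst z = vfst w \<and> vsnd z = vsnd w"
proof
  assume "vfst z = vfst w \<and> vsnd z = vsnd w"
  then have "z $ p = w $ p" for p
    by (cases p) (auto simp: vfst_def vsnd_def vec_eq_iff)
  then show "z = w" by (simp add: vec_eq_iff)
qed auto

lemma vfst_vsnd_simps [simp]:
  "vfst (z + w) = vfst z + vfst w" "vsnd (z + w) = vsnd z + vsnd w"
  "vfst (z - w) = vfst z - vfst w" "vsnd (z - w) = vsnd z - vsnd w"
  "vfst (c *\<^sub>R z) = c *\<^sub>R vfst z" "vsnd (c *\<^sub>R z) = c *\<^sub>R vsnd z"
  "vfst 0 = 0" "vsnd 0 = 0"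
  by (auto simp: vfst_def vsnd_def vec_eq_iff)

lemma norm_vfst_vsnd: "(norm z)\<^sup>2 = (norm (vfst z))\<^sup>2 + (norm (vsnd z))\<^sup>2"
  by (simp add: norm_vec_def L2_set_def sum_nonneg sum_UNIV_Plus vfst_def vsnd_def)

lemma blk_mult_vec [simp]:
  "vfst (blk A B C E *v z) = A *v vfst z + B *v vsnd z"
  "vsnd (blk A B C E *v z) = C *v vfst z + E *v vsnd z"
  by (simp_all add: vec_eq_iff matrix_vector_mult_def blk_def vfst_def vsnd_def sum_UNIV_Plus)

lemma blk_add: "blk A B C E + blk A' B' C' E' = blk (A + A') (B + B') (C + C') (E + E')"
  by (simp add: vec_eq_iff blk_def split: sum.splits)

lemma blk_diff: "blk A B C E - blk A' B' C' E' = blk (A - A') (B - B') (C - C') (E - E')"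
  by (simp add: vec_eq_iff blk_def split: sum.splits)

lemma scaled_mat_1_blk: "c *\<^sub>R (mat 1 :: real^('n::finite + 'n)^('n + 'n)) = blk (c *\<^sub>R mat 1) 0 0 (c *\<^sub>R mat 1)"
  by (simp add: vec_eq_iff blk_def mat_def split: sum.splits)

lemma scaled_mat_1_mult_vec [simp]: "(c *\<^sub>R mat 1) *v x = c *\<^sub>R (x :: real^'n)"
  by (simp add: scaleR_matrix_vector_assoc[symmetric])

lemma matrix_vector_mult_uminus [simp]: "(- A) *v x = - (A *v (x :: real^'n))"
  using matrix_vector_mult_diff_rdistrib[of 0 A x] by simp

lemma inner_matrix_vector_symmetric:
  fixes A :: "real^'n^'n"
  assumes "\<And>i j. A $ i $ j = A $ j $ i"
  shows "(A *v x) \<bullet> y = x \<bullet> (A *v y)"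
proof -
  have "transpose A = A" using assms by (simp add: transpose_def vec_eq_iff)
  then show ?thesis by (metis dot_lmul_matrix inner_commute transpose_matrix_vector)
qed

text \<open>The off-diagonal blocks \<^term>\<open>- mat 1\<close> and \<^term>\<open>mat 1\<close> contribute cross terms that cancel by symmetry.\<close>
lemma norm_blk_skew:
  fixes A :: "real^'n^'n"
  assumes "\<And>i j. A $ i $ j = A $ j $ i"
  shows "(norm (blk A (- mat 1) (mat 1) A *v z))\<^sup>2
     = (norm (A *v vfst z))\<^sup>2 + (norm (A *v vsnd z))\<^sup>2 + (norm z)\<^sup>2"
    and "(norm (blk A (mat 1) (- mat 1) A *v z))\<^sup>2
     = (norm (A *v vfst z))\<^sup>2 + (norm (A *v vsnd z))\<^sup>2 + (norm z)\<^sup>2"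
  using inner_matrix_vector_symmetric[OF assms, of "vfst z" "vsnd z"]
  unfolding norm_vfst_vsnd[of z] norm_vfst_vsnd[of "blk _ _ _ _ *v z"] blk_mult_vec
  by (simp_all add: power2_norm_eq_inner inner_add inner_diff inner_commute)

text \<open>This is the origin of the factors sqrt (1 + l^2) in the denominator of \<xi>: the skew
  identity blocks add (norm z)^2 to the contribution of \<open>A\<close>.\<close>

lemma norm_blk_skew_ge:
  fixes A :: "real^'n^'n"
  assumes sym: "\<And>i j. A $ i $ j = A $ j $ i" and "0 \<le> l" and le: "\<And>x. l * norm x \<le> norm (A *v x)"
  shows "sqrt (1 + l\<^sup>2) * norm z \<le> norm (blk A (- mat 1) (mat 1) A *v z)"
proof (rule power2_le_imp_le)
  have "l\<^sup>2 * (norm x)\<^sup>2 \<le> (norm (A *v x))\<^sup>2" for x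
    using power_mono[OF le, of x 2] \<open>0 \<le> l\<close> by (simp add: power_mult_distrib)
  from this[of "vfst z"] this[of "vsnd z"]
  show "(sqrt (1 + l\<^sup>2) * norm z)\<^sup>2 \<le> (norm (blk A (- mat 1) (mat 1) A *v z))\<^sup>2"
    by (simp add: norm_blk_skew[OF sym] power_mult_distrib norm_vfst_vsnd[of z] algebra_simps)
qed simp

text \<open>The version with exchanged signs serves \<omega>I - H, where subtraction flips the
  off-diagonal blocks.\<close>

lemma norm_blk_skew_le:
  fixes A :: "real^'n^'n"
  assumes sym: "\<And>i j. A $ i $ j = A $ j $ i" and "0 \<le> l" and le: "\<And>x. norm (A *v x) \<le> l * norm x"
  shows "norm (blk A (- mat 1) (mat 1) A *v z) \<le> sqrt (1 + l\<^sup>2) * norm z"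
    and "norm (blk A (mat 1) (- mat 1) A *v z) \<le> sqrt (1 + l\<^sup>2) * norm z"
proof -
  have "(norm (A *v x))\<^sup>2 \<le> l\<^sup>2 * (norm x)\<^sup>2" for x
    using power_mono[OF le, of x 2] \<open>0 \<le> l\<close> by (simp add: power_mult_distrib)
  from this[of "vfst z"] this[of "vsnd z"]
  have *: "(norm (A *v vfst z))\<^sup>2 + (norm (A *v vsnd z))\<^sup>2 + (norm z)\<^sup>2 \<le> (sqrt (1 + l\<^sup>2) * norm z)\<^sup>2"
    by (simp add: power_mult_distrib norm_vfst_vsnd[of z] algebra_simps)
  show "norm (blk A (- mat 1) (mat 1) A *v z) \<le> sqrt (1 + l\<^sup>2) * norm z"
    by (rule power2_le_imp_le) (use * in \<open>simp_all add: norm_blk_skew[OF sym]\<close>)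
  show "norm (blk A (mat 1) (- mat 1) A *v z) \<le> sqrt (1 + l\<^sup>2) * norm z"
    by (rule power2_le_imp_le) (use * in \<open>simp_all add: norm_blk_skew[OF sym]\<close>)
qed

lemma norm_blk_diag_le:
  fixes A :: "real^'n^'n"
  assumes "0 \<le> l" and le: "\<And>x. norm (A *v x) \<le> l * norm x"
  shows "norm (blk A 0 0 A *v z) \<le> l * norm z"
proof (rule power2_le_imp_le)
  have "(norm (A *v x))\<^sup>2 \<le> l\<^sup>2 * (norm x)\<^sup>2" for x
    using power_mono[OF le, of x 2] \<open>0 \<le> l\<close> by (simp add: power_mult_distrib)
  from this[of "vfst z"] this[of "vsnd z"]
  show "(norm (blk A 0 0 A *v z))\<^sup>2 \<le> (l * norm z)\<^sup>2"
    by (simp add: norm_vfst_vsnd[of "_ *v _"] power_mult_distrib norm_vfst_vsnd[of z] algebra_simps)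
qed (use assms in simp)

section \<open>Rank, invertibility and the Cayley transform\<close>

text \<open>The range lies in the coordinate subspace on \<open>S\<close>, and \<open>A\<close> is
  injective on that subspace. Comparing dimensions from both sides gives card S.\<close>

lemma rank_eq_card_support:
  fixes A :: "real^'m^'m"
  assumes range: "\<And>x i. i \<notin> S \<Longrightarrow> (A *v x) $ i = 0"
    and inj: "\<And>y. (\<And>i. i \<notin> S \<Longrightarrow> y $ i = 0) \<Longrightarrow> A *v y = 0 \<Longrightarrow> y = 0"
  shows "rank A = card S"
proof -
  let ?V = "{x::real^'m. \<forall>i. i \<notin> S \<longrightarrow> x $ i = 0}"
  have d: "dim ?V = card S"
    by (simp add: dim_substandard_cart flip: dim_vec_eq)
  have sub: "subspace ?V" by (auto simp: subspace_def)
  have "inj_on ((*v) A) ?V"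
  proof (rule inj_onI)
    fix x y assume "x \<in> ?V" "y \<in> ?V" "A *v x = A *v y"
    then have "A *v (x - y) = 0" by (simp add: matrix_vector_mult_diff_distrib)
    then have "x - y = 0" by (rule inj[rotated]) (use \<open>x \<in> ?V\<close> \<open>y \<in> ?V\<close> in simp)
    then show "x = y" by simp
  qed
  then have "dim ((*v) A ` ?V) = dim ?V"
    by (intro dim_image_eq) (simp_all add: span_eq_iff[THEN iffD2, OF sub] del: span_eq_iff)
  moreover have "dim ((*v) A ` ?V) \<le> dim (range ((*v) A))" by (intro dim_subset) auto
  moreover have "dim (range ((*v) A)) \<le> dim ?V" by (intro dim_subset) (use range in blast)
  ultimately show ?thesis by (simp add: rank_dim_range d)
qed

lemma invertible_injective:
  fixes A :: "real^'n^'n"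
  assumes "\<And>x. A *v x = 0 \<Longrightarrow> x = 0"
  shows "invertible A"
  using assms by (simp add: invertible_left_inverse matrix_left_invertible_ker)

lemma rank_mult_invertible_right:
  fixes A P :: "real^'n^'n"
  assumes "invertible P"
  shows "rank (A ** P) = rank A"
proof (rule antisym)
  obtain Q where "P ** Q = mat 1" using assms by (auto simp: invertible_def)
  then have "A = (A ** P) ** Q" by (simp add: matrix_mul_assoc[symmetric])
  then show "rank A \<le> rank (A ** P)" by (metis rank_mul_le_left)
qed (rule rank_mul_le_left)

lemma rank_mult_invertible_left:
  fixes A P :: "real^'n^'n"
  assumes "invertible P"
  shows "rank (P ** A) = rank A"
proof (rule antisym)
  obtain Q where "Q ** P = mat 1" using assms by (auto simp: invertible_def)
  then have "A = Q ** (P ** A)" by (simp add: matrix_mul_assoc)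
  then show "rank A \<le> rank (P ** A)" by (metis rank_mul_le_right)
qed (rule rank_mul_le_right)

lemma specnorm_le:
  assumes "\<And>x. norm (A *v x) \<le> c * norm x"
  shows "specnorm A \<le> c"
  unfolding specnorm_def using assms by (rule onorm_le)

lemma diag_mult_vec_nth:
  fixes B :: "real^'n^'n"
  assumes "\<And>i j. i \<noteq> j \<Longrightarrow> B $ i $ j = 0"
  shows "(B *v x) $ i = B $ i $ i * x $ i"
proof -
  have "(B *v x) $ i = (\<Sum>j\<in>{i}. B $ i $ j * x $ j)"
    unfolding matrix_vector_mult_def vec_lambda_beta by (rule sum.mono_neutral_right) (auto simp: assms)
  then show ?thesis by simp
qed

text \<open>Here u is minus the Cayley transform of v, given by an equation so that no inverse is
  involved. Componentwise the claim is |\<omega> - b| \<le> \<omega> + b for b \<ge> 0.\<close>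

lemma norm_diag_cayley_le:
  fixes B :: "real^'m^'m" and u v :: "real^'m"
  assumes offdiag: "\<And>i j. i \<noteq> j \<Longrightarrow> B $ i $ j = 0" and nonneg: "\<And>i. 0 \<le> B $ i $ i"
    and "\<omega> > 0" and eq: "\<omega> *\<^sub>R u + B *v u = - (\<omega> *\<^sub>R v - B *v v)"
  shows "norm u \<le> norm v"
proof (rule norm_le_componentwise_cart)
  fix i
  have "(\<omega> + B $ i $ i) * u $ i = - ((\<omega> - B $ i $ i) * v $ i)"
    using arg_cong[OF eq, of "\<lambda>x. x $ i"] by (simp add: diag_mult_vec_nth[OF offdiag] algebra_simps)
  then have "(\<omega> + B $ i $ i) * \<bar>u $ i\<bar> = \<bar>\<omega> - B $ i $ i\<bar> * \<bar>v $ i\<bar>"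
    using nonneg[of i] \<open>\<omega> > 0\<close> by (metis abs_minus_cancel abs_mult abs_of_pos add_pos_nonneg)
  also have "\<dots> \<le> (\<omega> + B $ i $ i) * \<bar>v $ i\<bar>"
    using nonneg[of i] \<open>\<omega> > 0\<close> by (intro mult_right_mono) auto
  finally show "norm (u $ i) \<le> norm (v $ i)"
    using nonneg[of i] \<open>\<omega> > 0\<close> by (simp add: mult_le_cancel_left)
qed

lemma matrix_add_distrib: "(A + B) ** C = A ** C + B ** (C :: real^'n^'m)"
  by (simp add: matrix_matrix_mult_def vec_eq_iff sum.distrib algebra_simps)

lemma matrix_inv_mult:
  fixes A :: "real^'n^'n"
  assumes "invertible A"
  shows "A ** matrix_inv A = mat 1" "matrix_inv A ** A = mat 1"
  using someI_ex[OF assms[unfolded invertible_def]] by (simp_all add: matrix_inv_def)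

lemma matrix_inv_mult_cancel:
  fixes A R :: "real^'n^'n"
  assumes "invertible A"
  shows "A ** (matrix_inv A ** R) = R" "matrix_inv A ** (A ** R) = R"
  using matrix_inv_mult[OF assms] by (simp_all add: matrix_mul_assoc)

text \<open>The linear algebra of the theorem, with \<open>T\<close> and \<open>C\<close> entering
  through norm bounds and a splitting of T - C. With G the inverse of \<omega>I + \<C> and W =
  F^(-1) \<R>, the witnesses are G diag(P,P) W and G diag(Q,Q) W. \<open>X\<close> is the product of
  the bounds for G and W, and the rank survives because both are invertible.\<close>

lemma preconditioner_perturbation:
  fixes T C D P Q :: "real^'n^'n"
  assumes "\<omega> > 0"
    and symT: "\<And>i j. T $ i $ j = T $ j $ i" and symC: "\<And>i j. C $ i $ j = C $ j $ i"
    and D: "\<And>i j. i \<noteq> j \<Longrightarrow> D $ i $ j = 0" "\<And>i. D $ i $ i \<le> 0"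
    and posT: "\<And>x. x \<noteq> 0 \<Longrightarrow> x \<bullet> (T *v x) > 0"
    and l: "0 \<le> lT" "0 \<le> lC" "0 \<le> L"
    and lT: "\<And>x. lT * norm x \<le> norm ((\<omega> *\<^sub>R mat 1 + T) *v x)"
    and lC: "\<And>x. lC * norm x \<le> norm ((\<omega> *\<^sub>R mat 1 + C) *v x)"
    and L: "\<And>x. norm ((\<omega> *\<^sub>R mat 1 + T) *v x) \<le> L * norm x"
      "\<And>x. norm ((\<omega> *\<^sub>R mat 1 - T) *v x) \<le> L * norm x"
    and split: "T - C = P + Q"
    and pq: "0 \<le> p" "0 \<le> q" "\<And>x. norm (P *v x) \<le> p * norm x" "\<And>x. norm (Q *v x) \<le> q * norm x"
    and R_def: "\<R> = blk (T - D) (- mat 1) (mat 1) (T - D)"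
    and B_def: "\<B> = blk (- D) 0 0 (- D)"
    and H_def: "\<H> = blk T (- mat 1) (mat 1) T"
    and C_def: "\<C> = blk C (- mat 1) (mat 1) C"
    and F_def: "F = (1 / (2 * \<omega>)) *\<^sub>R ((\<omega> *\<^sub>R mat 1 + \<B>) ** (\<omega> *\<^sub>R mat 1 + \<H>))"
    and Ft_def: "Ft = (1 / (2 * \<omega>)) *\<^sub>R ((\<omega> *\<^sub>R mat 1 + \<B>) ** (\<omega> *\<^sub>R mat 1 + \<C>))"
    and X_def: "X = 2 * sqrt (1 + L\<^sup>2) / (sqrt (1 + lC\<^sup>2) * sqrt (1 + lT\<^sup>2))"
  shows "\<exists>Mw Nw :: real^('n + 'n)^('n + 'n). rank Mw = rank (blk P 0 0 P)
     \<and> specnorm Mw \<le> X * p \<and> specnorm Nw \<le> X * q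
     \<and> matrix_inv Ft ** \<R> = matrix_inv F ** \<R> + Mw + Nw"
proof -
  let ?X = "\<omega> *\<^sub>R mat 1 + \<B>" let ?Y = "\<omega> *\<^sub>R mat 1 + \<H>" let ?Z = "\<omega> *\<^sub>R mat 1 + \<C>"
  have Y: "?Y = blk (\<omega> *\<^sub>R mat 1 + T) (- mat 1) (mat 1) (\<omega> *\<^sub>R mat 1 + T)"
    and Z: "?Z = blk (\<omega> *\<^sub>R mat 1 + C) (- mat 1) (mat 1) (\<omega> *\<^sub>R mat 1 + C)"
    and Y': "\<omega> *\<^sub>R mat 1 - \<H> = blk (\<omega> *\<^sub>R mat 1 - T) (mat 1) (- mat 1) (\<omega> *\<^sub>R mat 1 - T)"
    by (simp_all add: H_def C_def scaled_mat_1_blk blk_add blk_diff)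
  have sym: "(\<omega> *\<^sub>R mat 1 + T) $ i $ j = (\<omega> *\<^sub>R mat 1 + T) $ j $ i"
    "(\<omega> *\<^sub>R mat 1 - T) $ i $ j = (\<omega> *\<^sub>R mat 1 - T) $ j $ i"
    "(\<omega> *\<^sub>R mat 1 + C) $ i $ j = (\<omega> *\<^sub>R mat 1 + C) $ j $ i" for i j
    using symT[of i j] symC[of i j] by (simp_all add: mat_def)
  have Yge: "sqrt (1 + lT\<^sup>2) * norm z \<le> norm (?Y *v z)" for z
    unfolding Y by (rule norm_blk_skew_ge[OF sym(1) l(1) lT])
  have Zge: "sqrt (1 + lC\<^sup>2) * norm z \<le> norm (?Z *v z)" for z
    unfolding Z by (rule norm_blk_skew_ge[OF sym(3) l(2) lC])
  have Yle: "norm (?Y *v z) \<le> sqrt (1 + L\<^sup>2) * norm z" for z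
    unfolding Y by (rule norm_blk_skew_le(1)[OF sym(1) l(3) L(1)])
  have Y'le: "norm ((\<omega> *\<^sub>R mat 1 - \<H>) *v z) \<le> sqrt (1 + L\<^sup>2) * norm z" for z
    unfolding Y' by (rule norm_blk_skew_le(2)[OF sym(2) l(3) L(2)])
  have sqpos: "sqrt (1 + t\<^sup>2) > 0" for t :: real by (simp add: add_pos_nonneg)
  have Boff: "\<B> $ i $ j = 0" if "i \<noteq> j" for i j
    using that D(1) by (auto simp: B_def blk_def split: sum.splits)
  have Bnn: "0 \<le> \<B> $ i $ i" for i
    using D(2) by (auto simp: B_def blk_def split: sum.splits)
  have invX: "invertible ?X"
  proof (rule invertible_injective)
    fix x assume "?X *v x = 0"
    \<comment> \<open>The Cayley bound with v = 0 shows that the kernel is trivial.\<close>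
    then have "norm x \<le> norm (0 :: real^('n + 'n))"
      by (intro norm_diag_cayley_le[OF Boff Bnn \<open>\<omega> > 0\<close>]) (simp_all add: matrix_vector_mult_add_rdistrib)
    then show "x = 0" by simp
  qed
  have invY: "invertible ?Y"
  proof (rule invertible_injective)
    fix x assume "?Y *v x = 0"
    then show "x = 0" using Yge[of x] sqpos[of lT] by (simp add: mult_le_0_iff)
  qed
  have invZ: "invertible ?Z"
  proof (rule invertible_injective)
    fix x assume "?Z *v x = 0"
    then show "x = 0" using Zge[of x] sqpos[of lC] by (simp add: mult_le_0_iff)
  qed
  have invsc: "invertible ((1 / (2 * \<omega>)) *\<^sub>R A)" if "invertible A" for A :: "real^('n + 'n)^('n + 'n)"
  proof (rule invertible_injective)
    fix x assume "((1 / (2 * \<omega>)) *\<^sub>R A) *v x = 0"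
    then have "A *v x = 0" using \<open>\<omega> > 0\<close> by (simp add: scaleR_matrix_vector_assoc[symmetric])
    then have "matrix_inv A *v (A *v x) = 0" by simp
    then show "x = 0" using matrix_inv_mult[OF that] by (simp add: matrix_vector_mul_assoc)
  qed
  have invF: "invertible F" unfolding F_def by (intro invsc invertible_mult invX invY)
  have invFt: "invertible Ft" unfolding Ft_def by (intro invsc invertible_mult invX invZ)
  have posTD: "x \<bullet> ((T - D) *v x) > 0" if "x \<noteq> 0" for x
  proof -
    have "x \<bullet> (D *v x) = (\<Sum>i\<in>UNIV. D $ i $ i * (x $ i)\<^sup>2)"
      by (simp add: inner_vec_def diag_mult_vec_nth[OF D(1)] power2_eq_square mult_ac)
    also have "\<dots> \<le> 0" by (intro sum_nonpos mult_nonpos_nonneg D(2)) auto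
    finally show ?thesis using posT[OF that]
      by (simp add: matrix_vector_mult_diff_rdistrib inner_diff)
  qed
  have invR: "invertible \<R>"
  proof (rule invertible_injective)
    fix z assume "\<R> *v z = 0"
    then have "vfst (\<R> *v z) = 0" "vsnd (\<R> *v z) = 0" by simp_all
    \<comment> \<open>For z = (u, v) in the kernel the two quadratic forms equal u.v and -v.u. Their
      sum is zero, so positive definiteness forces u = v = 0.\<close>
    then have "(T - D) *v vfst z = vsnd z" "(T - D) *v vsnd z = - vfst z"
      by (simp_all add: R_def add_eq_0_iff)
    then have sum0: "vfst z \<bullet> ((T - D) *v vfst z) + vsnd z \<bullet> ((T - D) *v vsnd z) = 0"
      by (simp add: inner_commute)
    have nn: "0 \<le> x \<bullet> ((T - D) *v x)" for x
      using posTD[of x] by (cases "x = 0") auto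
    have "vfst z = 0"
      by (rule ccontr) (use posTD[of "vfst z"] nn[of "vsnd z"] sum0 in linarith)
    moreover have "vsnd z = 0"
      by (rule ccontr) (use posTD[of "vsnd z"] nn[of "vfst z"] sum0 in linarith)
    ultimately show "z = 0" by (simp add: vec_sum_eq_iff)
  qed
  define W where "W = matrix_inv F ** \<R>"
  define Wt where "Wt = matrix_inv Ft ** \<R>"
  define G where "G = matrix_inv ?Z"
  have invW: "invertible W"
    unfolding W_def using invF invR
    by (intro invertible_mult) (auto simp: invertible_def intro: matrix_inv_mult[OF invF])
  have invG: "invertible G"
    unfolding G_def using matrix_inv_mult[OF invZ] by (auto simp: invertible_def)
  have FW: "(1 / (2 * \<omega>)) *\<^sub>R (?X ** (?Y ** W)) = \<R>"
    using matrix_inv_mult_cancel(1)[OF invF, of \<R>]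
    by (simp add: W_def F_def matrix_mul_assoc scalar_matrix_assoc)
  have FWt: "(1 / (2 * \<omega>)) *\<^sub>R (?X ** (?Z ** Wt)) = \<R>"
    using matrix_inv_mult_cancel(1)[OF invFt, of \<R>]
    by (simp add: Wt_def Ft_def matrix_mul_assoc scalar_matrix_assoc)
  have "?X ** (?Z ** Wt) = ?X ** (?Y ** W)"
    using trans[OF FWt FW[symmetric]] \<open>\<omega> > 0\<close> by simp
  \<comment> \<open>Both products equal 2\<omega>\<R>, and the common left factor \<omega>I + \<B>
    cancels.\<close>
  then have ZW: "?Z ** Wt = ?Y ** W"
    using matrix_inv_mult_cancel(2)[OF invX] by metis
  have YZ: "?Y = ?Z + blk P 0 0 P + blk Q 0 0 Q"
  proof -
    have "T = C + P + Q" using split by (simp add: algebra_simps)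
    then show ?thesis unfolding Y Z blk_add by (simp add: add_ac)
  qed
  have "Wt = G ** (?Y ** W)"
    using matrix_inv_mult_cancel(2)[OF invZ, of Wt] ZW by (simp add: G_def)
  also have "\<dots> = G ** (?Z ** W) + G ** (blk P 0 0 P ** W) + G ** (blk Q 0 0 Q ** W)"
    unfolding YZ by (simp add: matrix_add_distrib matrix_add_ldistrib)
  also have "G ** (?Z ** W) = W" unfolding G_def by (rule matrix_inv_mult_cancel(2)[OF invZ])
  finally have eq: "Wt = W + G ** (blk P 0 0 P ** W) + G ** (blk Q 0 0 Q ** W)" .

  have Gle: "norm (G *v z) \<le> norm z / sqrt (1 + lC\<^sup>2)" for z
  proof -
    have "?Z *v (G *v z) = z"
      using matrix_inv_mult[OF invZ] by (simp add: G_def matrix_vector_mul_assoc)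
    then show ?thesis using Zge[of "G *v z"] sqpos[of lC] by (simp add: field_simps)
  qed
  have Wle: "norm (W *v z) \<le> 2 * sqrt (1 + L\<^sup>2) / sqrt (1 + lT\<^sup>2) * norm z" for z
  proof -
    \<comment> \<open>By the identity (\<omega>+B)(\<omega>+H) - (\<omega>-B)(\<omega>-H) =
      2\<omega>(B+H), the vector \<open>w\<close> is (\<omega>I+\<H>)z plus minus the Cayley
      transform of v = (\<omega>I-\<H>)z. The correction \<open>u\<close> is thus no longer than
      \<open>v\<close>, and both summands obey the same bound; hence the factor 2.\<close>
    define w where "w = ?Y *v (W *v z)"
    define u where "u = w - ?Y *v z"
    define v where "v = (\<omega> *\<^sub>R mat 1 - \<H>) *v z"
    have "\<R> = \<B> + \<H>" by (simp add: R_def B_def H_def blk_add)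
    then have "?X *v w = (2 * \<omega>) *\<^sub>R (\<B> *v z + \<H> *v z)"
      using arg_cong[OF FW, of "\<lambda>A. (2 * \<omega>) *\<^sub>R (A *v z)"] \<open>\<omega> > 0\<close>
      by (simp add: w_def matrix_vector_mul_assoc scaleR_matrix_vector_assoc[symmetric]
          matrix_vector_mult_add_rdistrib[of \<B>] matrix_mul_assoc)
    then have Bw: "\<B> *v w = \<omega> *\<^sub>R (\<B> *v z + \<H> *v z) + \<omega> *\<^sub>R (\<B> *v z + \<H> *v z) - \<omega> *\<^sub>R w"
      by (simp add: matrix_vector_mult_add_rdistrib scaleR_2[symmetric] eq_diff_eq add.commute)
    have u: "u = w - (\<omega> *\<^sub>R z + \<H> *v z)" and v: "v = \<omega> *\<^sub>R z - \<H> *v z"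
      by (simp_all add: u_def v_def matrix_vector_mult_add_rdistrib matrix_vector_mult_diff_rdistrib)
    have "\<omega> *\<^sub>R u + \<B> *v u = - (\<omega> *\<^sub>R v - \<B> *v v)"
      unfolding u v matrix_vector_mult_diff_distrib matrix_vector_right_distrib Bw matrix_vector_mult_scaleR
      by (simp add: algebra_simps)
    then have "norm u \<le> norm v"
      using norm_diag_cayley_le[of \<B> \<omega> u v] Boff Bnn \<open>\<omega> > 0\<close> by blast
    have "norm w \<le> norm (?Y *v z) + norm u"
      using norm_triangle_ineq[of "?Y *v z" u] by (simp add: u_def)
    also have "\<dots> \<le> 2 * sqrt (1 + L\<^sup>2) * norm z"
      using Yle[of z] Y'le[of z] \<open>norm u \<le> norm v\<close> by (simp add: v_def)
    finally have "sqrt (1 + lT\<^sup>2) * norm (W *v z) \<le> 2 * sqrt (1 + L\<^sup>2) * norm z"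
      using Yge[of "W *v z"] by (simp add: w_def)
    then show ?thesis using sqpos[of lT] by (simp add: field_simps)
  qed
  have bound: "specnorm (G ** (blk A 0 0 A ** W)) \<le> X * r"
    if "0 \<le> r" "\<And>x. norm (A *v x) \<le> r * norm x" for A r
  proof (rule specnorm_le)
    fix z
    have "norm ((G ** (blk A 0 0 A ** W)) *v z) = norm (G *v (blk A 0 0 A *v (W *v z)))"
      by (simp add: matrix_vector_mul_assoc)
    also have "\<dots> \<le> norm (blk A 0 0 A *v (W *v z)) / sqrt (1 + lC\<^sup>2)" by (rule Gle)
    also have "\<dots> \<le> r * norm (W *v z) / sqrt (1 + lC\<^sup>2)"
      by (intro divide_right_mono norm_blk_diag_le that) auto
    also have "\<dots> \<le> r * (2 * sqrt (1 + L\<^sup>2) / sqrt (1 + lT\<^sup>2) * norm z) / sqrt (1 + lC\<^sup>2)"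
      by (intro divide_right_mono mult_left_mono Wle that) auto
    also have "\<dots> = X * r * norm z" by (simp add: X_def mult_ac)
    finally show "norm ((G ** (blk A 0 0 A ** W)) *v z) \<le> X * r * norm z" .
  qed
  show ?thesis
  proof (intro exI conjI)
    show "rank (G ** (blk P 0 0 P ** W)) = rank (blk P 0 0 P)"
      by (simp add: rank_mult_invertible_left[OF invG] rank_mult_invertible_right[OF invW])
    show "specnorm (G ** (blk P 0 0 P ** W)) \<le> X * p" "specnorm (G ** (blk Q 0 0 Q ** W)) \<le> X * q"
      using pq by (auto intro!: bound)
    show "matrix_inv Ft ** \<R> = matrix_inv F ** \<R> + G ** (blk P 0 0 P ** W) + G ** (blk Q 0 0 Q ** W)"
      using eq by (simp add: W_def Wt_def)
  qed
qed

section \<open>Symmetric Toeplitz matrices\<close>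

text \<open>Entries depend on the distance of the indices only. \<open>T\<close>, \<open>C\<close>
  and both parts of T - C then share one format and are compared through their scalar
  functions.\<close>

definition symtoep :: "(nat \<Rightarrow> real) \<Rightarrow> ('n::finite \<Rightarrow> nat) \<Rightarrow> real^'n^'n" where
  "symtoep f ix = (\<chi> i j. f (nat \<bar>int (ix i) - int (ix j)\<bar>))"

lemma symtoep_sym: "symtoep f ix $ i $ j = symtoep f ix $ j $ i"
  by (simp add: symtoep_def abs_minus_commute)

lemma symtoep_diag: "symtoep f ix $ i $ i = f 0"
  by (simp add: symtoep_def)

text \<open>Row i meets the distances 1 to ix i on its left and 1 to M - 1 - ix i on its
  right.\<close>

lemma symtoep_row_sum:
  fixes ix :: "'n::finite \<Rightarrow> nat"
  assumes bij: "bij_betw ix UNIV {0..<M}"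
  shows "(\<Sum>j\<in>UNIV - {i}. \<bar>symtoep f ix $ i $ j\<bar>) = (\<Sum>d\<in>{1..ix i}. \<bar>f d\<bar>) + (\<Sum>d\<in>{1..<M - ix i}. \<bar>f d\<bar>)"
proof -
  let ?p = "ix i" let ?g = "\<lambda>q. \<bar>f (nat \<bar>int (ix i) - int q\<bar>)\<bar>"
  have p: "?p < M" using bij by (auto simp: bij_betw_def)
  have "inj_on ix (UNIV - {i})" using bij by (auto simp: bij_betw_def inj_on_def)
  moreover have "ix ` (UNIV - {i}) = {0..<M} - {?p}"
    using bij by (auto simp: bij_betw_def inj_on_def)
  ultimately have "(\<Sum>j\<in>UNIV - {i}. \<bar>symtoep f ix $ i $ j\<bar>) = (\<Sum>q\<in>{0..<M} - {?p}. ?g q)"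
    by (simp add: symtoep_def sum.reindex flip: \<open>ix ` (UNIV - {i}) = {0..<M} - {?p}\<close>)
  also have "{0..<M} - {?p} = {0..<?p} \<union> {Suc ?p..<M}" using p by auto
  also have "(\<Sum>q\<in>{0..<?p} \<union> {Suc ?p..<M}. ?g q) = (\<Sum>q\<in>{0..<?p}. ?g q) + (\<Sum>q\<in>{Suc ?p..<M}. ?g q)"
    by (rule sum.union_disjoint) auto
  also have "(\<Sum>q\<in>{0..<?p}. ?g q) = (\<Sum>d\<in>{1..?p}. \<bar>f d\<bar>)"
    by (rule sum.reindex_bij_witness[of _ "\<lambda>d. ?p - d" "\<lambda>q. ?p - q"])
       (auto simp: nat_diff_distrib' of_nat_diff intro!: arg_cong[of _ _ "\<lambda>x. \<bar>f x\<bar>"])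
  also have "(\<Sum>q\<in>{Suc ?p..<M}. ?g q) = (\<Sum>d\<in>{1..<M - ?p}. \<bar>f d\<bar>)"
    by (rule sum.reindex_bij_witness[of _ "\<lambda>d. d + ?p" "\<lambda>q. q - ?p"])
       (auto intro!: arg_cong[of _ _ "\<lambda>x. \<bar>f x\<bar>"])
  finally show ?thesis .
qed

lemma symtoep_diag_dominance:
  fixes ix :: "'n::finite \<Rightarrow> nat"
  assumes bij: "bij_betw ix UNIV {0..<M}"
  shows "norm (symtoep f ix *v x - f 0 *\<^sub>R x) \<le> 2 * (\<Sum>d\<in>{1..<M}. \<bar>f d\<bar>) * norm x"
proof (rule norm_mult_vec_minus_diag_le[OF symtoep_sym symtoep_diag])
  fix i
  have p: "ix i < M" using bij by (auto simp: bij_betw_def)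
  have "(\<Sum>d\<in>{1..ix i}. \<bar>f d\<bar>) \<le> (\<Sum>d\<in>{1..<M}. \<bar>f d\<bar>)" "(\<Sum>d\<in>{1..<M - ix i}. \<bar>f d\<bar>) \<le> (\<Sum>d\<in>{1..<M}. \<bar>f d\<bar>)"
    using p by (auto intro!: sum_mono2)
  then show "(\<Sum>j\<in>UNIV - {i}. \<bar>symtoep f ix $ i $ j\<bar>) \<le> 2 * (\<Sum>d\<in>{1..<M}. \<bar>f d\<bar>)"
    unfolding symtoep_row_sum[OF bij] by simp
qed

text \<open>In the circulant case the two half rows around the diagonal fit together to one full period.\<close>
lemma circulant_diag_dominance:
  fixes ix :: "'n::finite \<Rightarrow> nat"
  assumes bij: "bij_betw ix UNIV {0..<M}" and per: "\<And>d. 0 < d \<Longrightarrow> d < M \<Longrightarrow> f (M - d) = f d"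
  shows "norm (symtoep f ix *v x - f 0 *\<^sub>R x) \<le> (\<Sum>d\<in>{1..<M}. \<bar>f d\<bar>) * norm x"
proof (rule norm_mult_vec_minus_diag_le[OF symtoep_sym symtoep_diag])
  fix i
  have p: "ix i < M" using bij by (auto simp: bij_betw_def)
  have "(\<Sum>d\<in>{1..<M - ix i}. \<bar>f d\<bar>) = (\<Sum>d\<in>{Suc (ix i)..<M}. \<bar>f d\<bar>)"
    by (rule sum.reindex_bij_witness[of _ "\<lambda>d. M - d" "\<lambda>d. M - d"]) (use per in auto)
  moreover have "{1..<M} = {1..ix i} \<union> {Suc (ix i)..<M}" using p by auto
  then have "(\<Sum>d\<in>{1..<M}. \<bar>f d\<bar>) = (\<Sum>d\<in>{1..ix i}. \<bar>f d\<bar>) + (\<Sum>d\<in>{Suc (ix i)..<M}. \<bar>f d\<bar>)"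
    by (simp, intro sum.union_disjoint) auto
  ultimately show "(\<Sum>j\<in>UNIV - {i}. \<bar>symtoep f ix $ i $ j\<bar>) \<le> (\<Sum>d\<in>{1..<M}. \<bar>f d\<bar>)"
    unfolding symtoep_row_sum[OF bij] by simp
qed

text \<open>When \<open>f\<close> vanishes at distances below M/2, one of the two half rows around
  the diagonal vanishes in every row. This saves the factor 2 of the general Toeplitz bound.\<close>

lemma norm_symtoep_corner_le:
  fixes ix :: "'n::finite \<Rightarrow> nat"
  assumes bij: "bij_betw ix UNIV {0..<M}" and "M > 0" and zero: "\<And>d. 2 * d < M \<Longrightarrow> f d = 0"
  shows "norm (symtoep f ix *v x) \<le> (\<Sum>d\<in>{1..<M}. \<bar>f d\<bar>) * norm x"
proof -
  have "norm (symtoep f ix *v x - f 0 *\<^sub>R x) \<le> (\<Sum>d\<in>{1..<M}. \<bar>f d\<bar>) * norm x"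
  proof (rule norm_mult_vec_minus_diag_le[OF symtoep_sym symtoep_diag])
    fix i
    have p: "ix i < M" using bij by (auto simp: bij_betw_def)
    show "(\<Sum>j\<in>UNIV - {i}. \<bar>symtoep f ix $ i $ j\<bar>) \<le> (\<Sum>d\<in>{1..<M}. \<bar>f d\<bar>)"
    proof (cases "2 * ix i < M")
      case True
      then have "(\<Sum>d\<in>{1..ix i}. \<bar>f d\<bar>) = 0" by (intro sum.neutral) (auto intro!: zero)
      moreover have "(\<Sum>d\<in>{1..<M - ix i}. \<bar>f d\<bar>) \<le> (\<Sum>d\<in>{1..<M}. \<bar>f d\<bar>)"
        by (intro sum_mono2) auto
      ultimately show ?thesis unfolding symtoep_row_sum[OF bij] by simp
    next
      case False
      then have "(\<Sum>d\<in>{1..<M - ix i}. \<bar>f d\<bar>) = 0" by (intro sum.neutral) (auto intro!: zero)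
      moreover have "(\<Sum>d\<in>{1..ix i}. \<bar>f d\<bar>) \<le> (\<Sum>d\<in>{1..<M}. \<bar>f d\<bar>)"
        using p by (intro sum_mono2) auto
      ultimately show ?thesis unfolding symtoep_row_sum[OF bij] by simp
    qed
  qed
  then show ?thesis using zero[of 0] \<open>M > 0\<close> by simp
qed

lemma symtoep_corner_vanishes:
  assumes "\<And>d. d < M - k \<Longrightarrow> f d = 0" and "2 * k \<le> M" "k \<le> ix i" "ix i < M - k"
    and lt: "\<And>j. ix j < M"
  shows "(symtoep f ix *v x) $ i = 0"
proof -
  have "f (nat \<bar>int (ix i) - int (ix j)\<bar>) = 0" for j
    by (rule assms(1)) (use assms(2-4) lt[of i] lt[of j] in linarith)
  then show ?thesis by (simp add: symtoep_def matrix_vector_mult_def)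
qed

text \<open>The entries at distance at least M - k form two triangular blocks with the nonzero value
  f (M - k) on their diagonals. Substitution runs upwards through the first k indices and downwards
  through the last k.\<close>

lemma symtoep_corner_injective:
  fixes ix :: "'n::finite \<Rightarrow> nat" and y :: "real^'n"
  assumes bij: "bij_betw ix UNIV {0..<M}" and "2 * k \<le> M"
    and zero: "\<And>d. d < M - k \<Longrightarrow> f d = 0" and nz: "f (M - k) \<noteq> 0"
    and supp: "\<And>i. k \<le> ix i \<Longrightarrow> ix i < M - k \<Longrightarrow> y $ i = 0"
    and ker: "symtoep f ix *v y = 0"
  shows "y = 0"
proof -
  have lt: "ix i < M" for i using bij by (auto simp: bij_betw_def)
  have inj: "ix i = ix j \<longleftrightarrow> i = j" for i j using bij by (auto simp: bij_betw_def inj_on_def)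
  have ex: "\<exists>i. ix i = m" if "m < M" for m
    using bij that by (metis atLeastLessThan_iff bij_betw_def imageE zero_le)
  have row: "(\<Sum>j\<in>UNIV. f (nat \<bar>int (ix i) - int (ix j)\<bar>) * y $ j) = 0" for i
    using arg_cong[OF ker, of "\<lambda>v. v $ i"] by (simp add: symtoep_def matrix_vector_mult_def)
  have single: "y $ j = 0" if d: "nat \<bar>int (ix i) - int (ix j)\<bar> = M - k"
    and o: "\<And>l. l \<noteq> j \<Longrightarrow> f (nat \<bar>int (ix i) - int (ix l)\<bar>) * y $ l = 0" for i j
  proof -
    have "(\<Sum>l\<in>UNIV. f (nat \<bar>int (ix i) - int (ix l)\<bar>) * y $ l)
       = (\<Sum>l\<in>{j}. f (nat \<bar>int (ix i) - int (ix l)\<bar>) * y $ l)"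
      by (rule sum.mono_neutral_right) (use o in auto)
    then show ?thesis using row[of i] d nz by simp
  qed
  have low: "y $ j = 0" if "ix j < k" for j
    using that
  proof (induction "ix j" arbitrary: j rule: less_induct)
    case less
    \<comment> \<open>The row at distance exactly M - k from column j is chosen. Later columns are
      closer to it, so \<open>f\<close> vanishes there, and earlier ones are covered by the
      induction hypothesis.\<close>
    have "M - k + ix j < M" using less.prems assms(2) by linarith
    then obtain i where i: "ix i = M - k + ix j" using ex by blast
    show ?case
    proof (rule single[of i])
      show "nat \<bar>int (ix i) - int (ix j)\<bar> = M - k" using i by simp
      fix l assume "l \<noteq> j"
      then have ne: "ix l \<noteq> ix j" by (simp add: inj)
      show "f (nat \<bar>int (ix i) - int (ix l)\<bar>) * y $ l = 0"
      proof (cases "ix l < ix j")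
        case True then show ?thesis using less by simp
      next
        case False
        then have "nat \<bar>int (ix i) - int (ix l)\<bar> < M - k"
          using i ne lt[of l] lt[of i] less.prems \<open>2 * k \<le> M\<close> by linarith
        then show ?thesis by (simp add: zero)
      qed
    qed
  qed
  have high: "y $ j = 0" if "ix j \<ge> M - k" for j
    using that
  proof (induction "M - ix j" arbitrary: j rule: less_induct)
    case less
    have "ix j - (M - k) < M" using lt[of j] by linarith
    then obtain i where i: "ix i = ix j - (M - k)" using ex by blast
    show ?case
    proof (rule single[of i])
      show "nat \<bar>int (ix i) - int (ix j)\<bar> = M - k" using i less.prems by simp
      fix l assume "l \<noteq> j"
      then have ne: "ix l \<noteq> ix j" by (simp add: inj)
      show "f (nat \<bar>int (ix i) - int (ix l)\<bar>) * y $ l = 0"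
      proof (cases "ix l > ix j")
        case True then show ?thesis using less lt[of l] by simp
      next
        case False
        then have "nat \<bar>int (ix i) - int (ix l)\<bar> < M - k"
          using i ne lt[of l] lt[of j] less.prems \<open>2 * k \<le> M\<close> by linarith
        then show ?thesis by (simp add: zero)
      qed
    qed
  qed
  have "y $ j = 0" for j using low[of j] high[of j] supp[of j] by linarith
  then show ?thesis by (simp add: vec_eq_iff)
qed

text \<open>Each diagonal block is supported on the first k and the last k indices. These are
  disjoint as 2k \<le> M, so the two blocks together give 4k.\<close>

lemma rank_blk_symtoep_corner:
  fixes ix :: "'n::finite \<Rightarrow> nat"
  assumes bij: "bij_betw ix UNIV {0..<M}" and k: "2 * k \<le> M"
    and zero: "\<And>d. d < M - k \<Longrightarrow> f d = 0" and nz: "f (M - k) \<noteq> 0"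
  shows "rank (blk (symtoep f ix) 0 0 (symtoep f ix)) = 4 * k"
proof -
  define S where "S = {i. ix i < k \<or> M - k \<le> ix i}"
  have lt: "ix i < M" for i using bij by (auto simp: bij_betw_def)
  have "card S = card (ix ` S)"
    using bij by (intro card_image[symmetric]) (auto simp: bij_betw_def inj_on_def)
  also have "ix ` S = {0..<k} \<union> {M - k..<M}"
  proof -
    have "ix ` S = {m \<in> ix ` UNIV. m < k \<or> M - k \<le> m}" by (auto simp: S_def)
    then show ?thesis using bij k by (auto simp: bij_betw_def)
  qed
  also have "card ({0..<k} \<union> {M - k..<M}) = 2 * k"
    using k by (subst card_Un_disjoint) auto
  finally have cS: "card S = 2 * k" .
  have "rank (blk (symtoep f ix) 0 0 (symtoep f ix)) = card (S <+> S)"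
  proof (rule rank_eq_card_support)
    fix z p assume p: "p \<notin> S <+> S"
    have *: "(symtoep f ix *v x) $ i = 0" if "i \<notin> S" for x i
      by (rule symtoep_corner_vanishes[OF zero]) (use that k lt in \<open>auto simp: S_def\<close>)
    let ?w = "blk (symtoep f ix) 0 0 (symtoep f ix) *v z"
    show "?w $ p = 0"
    proof (cases p)
      case (Inl i)
      then have "?w $ p = vfst ?w $ i" by (simp add: vfst_def)
      then show ?thesis using * p Inl by (auto simp: blk_mult_vec)
    next
      case (Inr i)
      then have "?w $ p = vsnd ?w $ i" by (simp add: vsnd_def)
      then show ?thesis using * p Inr by (auto simp: blk_mult_vec)
    qed
  next
    fix z assume s: "\<And>p. p \<notin> S <+> S \<Longrightarrow> z $ p = 0" and "blk (symtoep f ix) 0 0 (symtoep f ix) *v z = 0"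
    then have "vfst (blk (symtoep f ix) 0 0 (symtoep f ix) *v z) = 0"
      "vsnd (blk (symtoep f ix) 0 0 (symtoep f ix) *v z) = 0" by simp_all
    then have "symtoep f ix *v vfst z = 0" "symtoep f ix *v vsnd z = 0" by simp_all
    moreover have "vfst z $ i = 0" "vsnd z $ i = 0" if "k \<le> ix i" "ix i < M - k" for i
    proof -
      have "Inl i \<notin> S <+> S" "Inr i \<notin> S <+> S" using that by (auto simp: S_def)
      then show "vfst z $ i = 0" "vsnd z $ i = 0" using s by (simp_all add: vfst_def vsnd_def)
    qed
    ultimately have "vfst z = 0" "vsnd z = 0"
      using symtoep_corner_injective[of ix M k f, OF bij k zero nz] by blast+
    then show "z = 0" by (simp add: vec_sum_eq_iff)
  qed
  then show ?thesis by (simp add: card_Plus cS)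
qed

section \<open>The Toeplitz matrix, Strang's circulant and their difference\<close>

lemma toeplitzT_eq_symtoep: "toeplitzT \<alpha> \<mu> ix = symtoep (\<lambda>d. \<mu> * cc \<alpha> (int d)) ix"
proof -
  have "cc \<alpha> k = cc \<alpha> \<bar>k\<bar>" for k by (simp add: abs_if cc_minus)
  then show ?thesis by (simp add: toeplitzT_def symtoep_def vec_eq_iff)
qed

definition strang_symbol :: "real \<Rightarrow> nat \<Rightarrow> nat \<Rightarrow> real" where
  "strang_symbol \<alpha> M d = (if 2 * d < M then cc \<alpha> (int d) else if 2 * d = M then 0 else cc \<alpha> (int (M - d)))"

text \<open>An offset -d is M - d modulo M, and the first row is symmetric under d -> M - d. The
  cyclic offset may therefore be replaced by the distance.\<close>

lemma strangC_eq_symtoep: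
  fixes ix :: "'n::finite \<Rightarrow> nat"
  assumes bij: "bij_betw ix UNIV {0..<M}"
  shows "strangC \<alpha> \<mu> M ix = symtoep (\<lambda>d. \<mu> * strang_symbol \<alpha> M d) ix"
proof -
  have "strangC \<alpha> \<mu> M ix $ i $ j = symtoep (\<lambda>d. \<mu> * strang_symbol \<alpha> M d) ix $ i $ j" for i j
  proof -
    have lt: "ix i < M" "ix j < M" using bij by (auto simp: bij_betw_def)
    show ?thesis
    proof (cases "ix i \<le> ix j")
      case True
      then have "(int (ix j) - int (ix i)) mod int M = int (ix j - ix i)"
        "nat \<bar>int (ix i) - int (ix j)\<bar> = ix j - ix i"
        using lt by (auto simp: of_nat_diff)
      then show ?thesis using lt
        by (auto simp: strangC_def symtoep_def strang_symbol_def Let_def of_nat_diff)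
    next
      case False
      define d where "d = ix i - ix j"
      have d: "0 < d" "d < M" "int (ix j) - int (ix i) = - int d" using lt False by (auto simp: d_def)
      have "(int (ix j) - int (ix i)) mod int M = (- int d + int M) mod int M" by (simp add: d)
      also have "\<dots> = int M - int d" using d by (subst mod_pos_pos_trivial) auto
      finally have "(int (ix j) - int (ix i)) mod int M = int M - int d" .
      moreover have "nat \<bar>int (ix i) - int (ix j)\<bar> = d"
        using d(3) by linarith
      ultimately show ?thesis using d(1,2)
        by (auto simp: strangC_def symtoep_def strang_symbol_def Let_def of_nat_diff)
    qed
  qed
  then show ?thesis by (simp add: vec_eq_iff)
qed

text \<open>Below M/2 the symbols agree, and at M/2 the defect is the coefficient itself. Beyond,
  c_(M-d) < c_d < 0 bounds the difference. The bound depends on M - d, so its sums are again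
  tails.\<close>

lemma strang_symbol_defect_le:
  assumes "0 < \<alpha>" "\<alpha> < 2" "d < M"
  shows "\<bar>cc \<alpha> (int d) - strang_symbol \<alpha> M d\<bar> \<le> - cc \<alpha> (int (M - d))"
proof (cases "2 * d \<le> M")
  case True
  then show ?thesis
  proof (cases "2 * d = M")
    case True
    then have "M - d = d" "d \<ge> 1" using assms by auto
    then show ?thesis using True cc_neg[OF assms(1,2), of d] by (simp add: strang_symbol_def)
  next
    case False
    then have "\<bar>cc \<alpha> (int d) - strang_symbol \<alpha> M d\<bar> = 0" using True by (simp add: strang_symbol_def)
    moreover have "cc \<alpha> (int (M - d)) < 0" using assms by (intro cc_neg) auto
    ultimately show ?thesis by linarith
  qed
next
  case False
  then have "cc \<alpha> (int (M - d)) < cc \<alpha> (int d)" using assms by (intro cc_strict_mono) auto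
  moreover have "cc \<alpha> (int d) < 0" using False assms by (intro cc_neg) auto
  ultimately show ?thesis using False by (simp add: strang_symbol_def)
qed

lemma cc_tail_pos:
  assumes "0 < \<alpha>" "\<alpha> < 2" "n \<ge> 1"
  shows "0 < cc_tail \<alpha> n"
  unfolding cc_tail_def using assms sin_pi_half_pos[of \<alpha>]
  by (intro mult_pos_pos divide_pos_pos Gamma_real_pos) auto

lemma cc_tail_antimono:
  assumes "0 < \<alpha>" "\<alpha> < 2" "1 \<le> m" "m \<le> n"
  shows "cc_tail \<alpha> n \<le> cc_tail \<alpha> m"
proof -
  have "0 \<le> - cc \<alpha> (int k)" if "k \<ge> 1" for k using cc_neg[OF assms(1,2) that] by simp
  then have "0 \<le> (\<Sum>k=m..<n. - cc \<alpha> (int k))"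
    using assms(3) by (intro sum_nonneg) auto
  then show ?thesis using sum_cc[OF assms] by simp
qed

text \<open>The entry at M/2 is zero and the two halves mirror each other. Each telescopes over 1 to
  M/2 - 1.\<close>

lemma sum_strang_symbol:
  assumes "0 < \<alpha>" "\<alpha> < 2" "even M" "M > 0"
  shows "(\<Sum>d\<in>{1..<M}. \<bar>strang_symbol \<alpha> M d\<bar>) = 2 * (cc_tail \<alpha> 1 - cc_tail \<alpha> (M div 2))"
proof -
  let ?n = "M div 2"
  have M: "M = 2 * ?n" "?n \<ge> 1" using assms by auto
  have "{1..<M} = {1..<?n} \<union> ({?n} \<union> {Suc ?n..<M})" using M by auto
  then have "(\<Sum>d\<in>{1..<M}. \<bar>strang_symbol \<alpha> M d\<bar>)
    = (\<Sum>d\<in>{1..<?n}. \<bar>strang_symbol \<alpha> M d\<bar>) + (\<Sum>d\<in>{?n} \<union> {Suc ?n..<M}. \<bar>strang_symbol \<alpha> M d\<bar>)"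
    by (simp only:) (rule sum.union_disjoint, auto)
  also have "(\<Sum>d\<in>{?n} \<union> {Suc ?n..<M}. \<bar>strang_symbol \<alpha> M d\<bar>) = (\<Sum>d\<in>{Suc ?n..<M}. \<bar>strang_symbol \<alpha> M d\<bar>)"
    using M(1) by (simp add: strang_symbol_def)
  also have "\<dots> = (\<Sum>d\<in>{Suc ?n..<M}. - cc \<alpha> (int (M - d)))"
  proof (rule sum.cong)
    fix d assume d: "d \<in> {Suc ?n..<M}"
    then have "cc \<alpha> (int (M - d)) < 0" by (intro cc_neg[OF assms(1,2)]) auto
    then show "\<bar>strang_symbol \<alpha> M d\<bar> = - cc \<alpha> (int (M - d))"
      using d M by (simp add: strang_symbol_def)
  qed simp
  also have "\<dots> = (\<Sum>d\<in>{1..<?n}. - cc \<alpha> (int d))"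
    by (rule sum.reindex_bij_witness[of _ "\<lambda>d. M - d" "\<lambda>d. M - d"]) (use M in auto)
  also have "(\<Sum>d\<in>{1..<?n}. \<bar>strang_symbol \<alpha> M d\<bar>) = (\<Sum>d\<in>{1..<?n}. - cc \<alpha> (int d))"
    by (rule sum.cong) (use M cc_neg[OF assms(1,2)] in \<open>auto simp: strang_symbol_def intro!: abs_of_neg\<close>)
  finally show ?thesis using sum_cc[OF assms(1,2), of 1 ?n] M by simp
qed

text \<open>All four follow from A x = d x + e with norm e \<le> r norm x. The third uses |\<omega>
  - d| \<le> \<omega> + d, the fourth Cauchy-Schwarz.\<close>

lemma norm_shifted_bounds:
  fixes A :: "real^'n^'n"
  assumes "0 \<le> \<omega>" "0 \<le> d" and dom: "\<And>x. norm (A *v x - d *\<^sub>R x) \<le> r * norm x"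
  shows "(\<omega> + d - r) * norm x \<le> norm ((\<omega> *\<^sub>R mat 1 + A) *v x)"
    and "norm ((\<omega> *\<^sub>R mat 1 + A) *v x) \<le> (\<omega> + d + r) * norm x"
    and "norm ((\<omega> *\<^sub>R mat 1 - A) *v x) \<le> (\<omega> + d + r) * norm x"
    and "(d - r) * (x \<bullet> x) \<le> x \<bullet> (A *v x)"
proof -
  define e where "e = A *v x - d *\<^sub>R x"
  have ne: "norm e \<le> r * norm x" unfolding e_def by (rule dom)
  have eq: "(\<omega> *\<^sub>R mat 1 + A) *v x = (\<omega> + d) *\<^sub>R x + e"
    "(\<omega> *\<^sub>R mat 1 - A) *v x = (\<omega> - d) *\<^sub>R x - e"
    by (simp_all add: e_def matrix_vector_mult_add_rdistrib matrix_vector_mult_diff_rdistrib algebra_simps)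
  have n: "norm ((\<omega> + d) *\<^sub>R x) = \<omega> * norm x + d * norm x"
    using assms(1,2) by (simp add: distrib_right)
  show "(\<omega> + d - r) * norm x \<le> norm ((\<omega> *\<^sub>R mat 1 + A) *v x)"
    unfolding eq using norm_diff_ineq[of "(\<omega> + d) *\<^sub>R x" e] ne n
    by (simp add: left_diff_distrib distrib_right)
  show "norm ((\<omega> *\<^sub>R mat 1 + A) *v x) \<le> (\<omega> + d + r) * norm x"
    unfolding eq using norm_triangle_ineq[of "(\<omega> + d) *\<^sub>R x" e] ne n
    by (simp add: distrib_right)
  have "norm ((\<omega> - d) *\<^sub>R x) \<le> \<omega> * norm x + d * norm x"
    unfolding norm_scaleR distrib_right[symmetric] using assms(1,2) by (intro mult_right_mono) auto
  then show "norm ((\<omega> *\<^sub>R mat 1 - A) *v x) \<le> (\<omega> + d + r) * norm x"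
    unfolding eq using norm_triangle_ineq4[of "(\<omega> - d) *\<^sub>R x" e] ne
    by (simp add: distrib_right)
  have "\<bar>x \<bullet> e\<bar> \<le> norm x * norm e" by (rule Cauchy_Schwarz_ineq2)
  also have "\<dots> \<le> norm x * (r * norm x)" by (intro mult_left_mono ne) auto
  also have "\<dots> = r * (x \<bullet> x)" by (simp add: power2_norm_eq_inner[symmetric] power2_eq_square)
  finally have "\<bar>x \<bullet> e\<bar> \<le> r * (x \<bullet> x)" .
  moreover have "x \<bullet> e = x \<bullet> (A *v x) - d * (x \<bullet> x)" by (simp add: e_def inner_diff)
  ultimately show "(d - r) * (x \<bullet> x) \<le> x \<bullet> (A *v x)" by (simp add: algebra_simps)
qed

text \<open>From ln (1 - u) \<le> -u with u = y/x. It is applied with x = 5 + \<alpha>/2 and y = 1 +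
  \<alpha> to the leading factors of \<theta>.\<close>

lemma one_minus_powr_exp_le_1:
  fixes x y :: real
  assumes "0 < x" "0 \<le> y" "y < x"
  shows "(1 - y / x) powr x * exp y \<le> 1"
proof -
  have u: "0 < 1 - y / x" using assms by simp
  have "x * ln (1 - y / x) \<le> x * (- (y / x))"
    using ln_add_one_self_le_self2[of "- (y / x)"] assms by (intro mult_left_mono) auto
  then have "x * ln (1 - y / x) + y \<le> 0" using assms by simp
  then have "exp (x * ln (1 - y / x) + y) \<le> 1" by simp
  then show ?thesis using u by (simp add: powr_def exp_add)
qed

theorem theorem5:
  fixes \<alpha> \<gamma> \<tau> a b \<omega> \<mu> h \<epsilon> :: real and M :: nat
    and ix :: "'n::finite \<Rightarrow> nat"
    and D :: "real^'n^'n"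
  assumes "1 < \<alpha>" "\<alpha> < 2" "\<gamma> > 0" "\<tau> > 0" "a < b"
    and "M \<ge> 8" "even M" "CARD('n) = M" "bij_betw ix UNIV {0..<M}"
    and "h = (b - a) / (real M + 1)" "\<mu> = \<gamma> * \<tau> / h powr \<alpha>"
    and "\<And>i j. i \<noteq> j \<Longrightarrow> D $ i $ j = 0" "\<And>i. D $ i $ i \<le> 0"
    and "\<omega> > 0"
    and "2 powr \<alpha> * \<mu> * \<theta>0 / (real M - 2) powr \<alpha> < \<epsilon>" "\<epsilon> \<le> \<mu> * \<theta>0"
    and "\<theta> = (1 - (1 + \<alpha>) / (5 + \<alpha>/2)) powr (5 + \<alpha>/2) * exp (1 + \<alpha>) * Gamma (\<alpha> + 1)
              * sin (pi * \<alpha> / 2) / (pi * \<alpha>)"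
    and "\<theta>0 = sqrt 2 * exp (13/12) * Gamma (1 + \<alpha>) * sin (pi * \<alpha> / 2) / (pi * \<alpha>)"
    and "c0 = Gamma (\<alpha> + 1) / Gamma (\<alpha>/2 + 1)^2"
    and "\<xi> = 2 * sqrt (real M) * sqrt (1 + (\<omega> + 2 * (Gamma (\<alpha> + 1) * \<mu> / Gamma (\<alpha>/2 + 1)^2
                 - \<theta> * \<gamma> * \<tau> / (b - a) powr \<alpha>))^2)
            / (sqrt (1 + (\<omega> + 2 powr (\<alpha> + 1) * \<gamma> * \<tau> * \<theta> / (b - a) powr \<alpha>)^2)
               * sqrt (1 + (\<omega> + 2 * \<gamma> * \<tau> * \<theta> / (b - a) powr \<alpha>)^2))"
    and "k0 = \<lceil>(\<mu> * \<theta>0 / \<epsilon>) powr (1 / \<alpha>)\<rceil> + 1"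
    and "T = toeplitzT \<alpha> \<mu> ix" "C = strangC \<alpha> \<mu> M ix"
    and "\<R> = blk (T - D) (- mat 1) (mat 1) (T - D)"
    and "\<B> = blk (- D) 0 0 (- D)"
    and "\<H> = blk T (- mat 1) (mat 1) T"
    and "\<C> = blk C (- mat 1) (mat 1) C"
    and "F = (1 / (2 * \<omega>)) *\<^sub>R ((\<omega> *\<^sub>R mat 1 + \<B>) ** (\<omega> *\<^sub>R mat 1 + \<H>))"
    and "Ft = (1 / (2 * \<omega>)) *\<^sub>R ((\<omega> *\<^sub>R mat 1 + \<B>) ** (\<omega> *\<^sub>R mat 1 + \<C>))"
  shows "\<exists>Mw Nw :: real^('n + 'n)^('n + 'n).
           int (rank Mw) = 4 * k0
         \<and> specnorm Mw \<le> \<mu> * \<xi> * (c0 / 2 - \<theta> / (real M - 1/2) powr \<alpha>)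
         \<and> specnorm Nw \<le> \<xi> * \<epsilon>
         \<and> matrix_inv Ft ** \<R> = matrix_inv F ** \<R> + Mw + Nw"
proof -

  \<comment> \<open>Comparison of the constants and lower bounds for the tails\<close>
  have \<alpha>: "0 < \<alpha>" "\<alpha> < 2" using assms(1,2) by auto
  \<comment> \<open>\<kappa> is the constant in the power bounds for \<open>cc_tail\<close>. Both
    given constants are compared with it: \<theta> \<le> \<kappa> \<le>
    \<open>\<theta>0\<close>.\<close>
  define \<kappa> where "\<kappa> = Gamma (\<alpha> + 1) * sin (pi * \<alpha> / 2) / (pi * \<alpha>)"
  have \<kappa>: "0 < \<kappa>" unfolding \<kappa>_def using \<alpha> sin_pi_half_pos[OF \<alpha>]
    by (intro divide_pos_pos mult_pos_pos Gamma_real_pos) auto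
  define \<rho> where "\<rho> = (1 - (1 + \<alpha>) / (5 + \<alpha>/2)) powr (5 + \<alpha>/2) * exp (1 + \<alpha>)"
  have \<rho>: "0 < \<rho>" "\<rho> \<le> 1"
    unfolding \<rho>_def using \<alpha> by (simp, intro one_minus_powr_exp_le_1) auto
  have \<theta>eq: "\<theta> = \<rho> * \<kappa>" unfolding assms(17) \<rho>_def \<kappa>_def by simp
  have \<theta>: "0 < \<theta>" "\<theta> \<le> \<kappa>" using \<theta>eq \<rho> \<kappa> by auto
  have \<theta>0: "\<kappa> \<le> \<theta>0"
  proof -
    have "1 * 1 \<le> sqrt 2 * exp (13/12 :: real)" by (intro mult_mono) auto
    then have "1 * \<kappa> \<le> sqrt 2 * exp (13/12) * \<kappa>" using \<kappa> by (intro mult_right_mono) auto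
    then show ?thesis unfolding assms(18) \<kappa>_def by (simp add: add.commute)
  qed
  have M8: "M \<ge> 8" "even M" using assms by auto
  have h: "0 < h" using assms(5,10) by simp
  have \<mu>: "0 < \<mu>" using assms(3,4,11) h by simp
  \<comment> \<open>The quantity shared by all three square roots of \<xi>; in terms of \<mu> it is
    \<mu> \<theta> / (M+1)^\<alpha>.\<close>
  define g where "g = \<gamma> * \<tau> * \<theta> / (b - a) powr \<alpha>"
  have g: "0 < g" using assms(3,4,5) \<theta> by (simp add: g_def)
  have g_eq: "g = \<mu> * (\<theta> / (real M + 1) powr \<alpha>)"
  proof -
    have "h powr \<alpha> = (b - a) powr \<alpha> / (real M + 1) powr \<alpha>"
      unfolding assms(10) by (rule powr_divide)
    then show ?thesis using assms(5) unfolding assms(11) g_def by simp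
  qed
  \<comment> \<open>The real \<open>y\<close> above \<open>n\<close> accommodates the arguments M +
    1, (M + 1)/2 and M - 1/2 at the integer indices M, M/2 and M - 1.\<close>
  have tail_ge: "\<theta> / y powr \<alpha> \<le> cc_tail \<alpha> n" if "1 \<le> n" "real n \<le> y" for n y
  proof -
    have "\<theta> / y powr \<alpha> \<le> \<kappa> / real n powr \<alpha>"
      using that \<theta> \<kappa> \<alpha> by (intro frac_le powr_mono2) auto
    also have "\<dots> \<le> cc_tail \<alpha> n" unfolding \<kappa>_def using cc_tail_lower[OF \<alpha> that(1)] .
    finally show ?thesis .
  qed
  have c0: "c0 = cc \<alpha> 0" "c0 = 2 * cc_tail \<alpha> 1"
    unfolding assms(19) using cc_0 cc_0_eq_tail[OF \<alpha>] by auto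
  have gT: "g \<le> \<mu> * cc_tail \<alpha> M"
    unfolding g_eq using M8 \<mu> by (intro mult_left_mono tail_ge) auto
  have gC: "2 powr \<alpha> * g \<le> \<mu> * cc_tail \<alpha> (M div 2)"
  proof -
    have "2 powr \<alpha> * g = \<mu> * (\<theta> / ((real M + 1) / 2) powr \<alpha>)"
      unfolding g_eq by (subst powr_divide) auto
    also have "\<dots> \<le> \<mu> * cc_tail \<alpha> (M div 2)"
      using M8 \<mu> by (intro mult_left_mono tail_ge) (auto simp: real_of_nat_div)
    finally show ?thesis .
  qed

  \<comment> \<open>The cutoff \<open>k0\<close>\<close>
  define x where "x = (\<mu> * \<theta>0 / \<epsilon>) powr (1 / \<alpha>)"
  have \<theta>0': "0 < \<theta>0" using \<kappa> \<theta>0 by simp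
  have \<epsilon>: "0 < \<epsilon>"
    using assms(15) \<mu> \<theta>0' M8 by (smt (verit) divide_nonneg_nonneg mult_nonneg_nonneg powr_ge_zero)
  have xp: "x powr \<alpha> = \<mu> * \<theta>0 / \<epsilon>"
    unfolding x_def using \<alpha> \<mu> \<theta>0' \<epsilon> by (simp add: powr_powr)
  have x1: "1 \<le> x"
    unfolding x_def using assms(16) \<epsilon> \<alpha> by (intro ge_one_powr_ge_zero) auto
  \<comment> \<open>The strict lower bound on \<epsilon> enters here; it keeps the two corner blocks
    of size \<open>k0\<close> disjoint.\<close>
  have xM: "x < (real M - 2) / 2"
  proof (rule ccontr)
    assume "\<not> ?thesis"
    then have "((real M - 2) / 2) powr \<alpha> \<le> x powr \<alpha>" using M8 \<alpha> by (intro powr_mono2) auto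
    then have "(real M - 2) powr \<alpha> / 2 powr \<alpha> \<le> \<mu> * \<theta>0 / \<epsilon>"
      using M8 by (simp add: xp powr_divide)
    then have "(real M - 2) powr \<alpha> * \<epsilon> \<le> 2 powr \<alpha> * \<mu> * \<theta>0"
      using \<epsilon> by (simp add: field_simps)
    moreover have "2 powr \<alpha> * \<mu> * \<theta>0 < (real M - 2) powr \<alpha> * \<epsilon>"
      using assms(15) M8 by (simp add: field_simps)
    ultimately show False by simp
  qed
  define k where "k = nat k0"
  have k0: "k0 = \<lceil>x\<rceil> + 1" unfolding assms(21) x_def ..
  have cl: "1 \<le> \<lceil>x\<rceil>" using x1 by linarith
  \<comment> \<open>As M is even, (M - 2)/2 is an integer, so rounding up does not exceed it and
    \<open>k0\<close> is at most M/2.\<close>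
  have "x \<le> of_int (int (M div 2) - 1)" using xM M8 by (auto simp: real_of_nat_div)
  then have cu: "\<lceil>x\<rceil> \<le> int (M div 2) - 1" by (rule ceiling_le)
  have k: "int k = k0" "2 \<le> k" "2 * k \<le> M" "x \<le> real k - 1"
  proof -
    show ik: "int k = k0" using cl k0 by (simp add: k_def)
    show "2 \<le> k" using ik cl k0 by linarith
    show "2 * k \<le> M" using ik cu k0 by linarith
    show "x \<le> real k - 1" using ik k0 le_of_int_ceiling[of x] by linarith
  qed
  have tail_k: "\<mu> * cc_tail \<alpha> (Suc k) \<le> \<epsilon>"
  proof -
    have "x powr \<alpha> \<le> real k powr \<alpha>" using k x1 \<alpha> by (intro powr_mono2) auto
    then have "\<mu> * \<theta>0 / real k powr \<alpha> \<le> \<epsilon>"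
      using \<epsilon> k unfolding xp by (simp add: field_simps)
    moreover have "cc_tail \<alpha> (Suc k) \<le> \<kappa> / real k powr \<alpha>"
      unfolding \<kappa>_def using k by (intro cc_tail_upper[OF \<alpha>]) auto
    then have "cc_tail \<alpha> (Suc k) \<le> \<theta>0 / real k powr \<alpha>"
      using \<theta>0 by (meson divide_right_mono order_trans powr_ge_zero)
    then have "\<mu> * cc_tail \<alpha> (Suc k) \<le> \<mu> * (\<theta>0 / real k powr \<alpha>)" using \<mu> by (intro mult_left_mono) auto
    ultimately show ?thesis by simp
  qed

  \<comment> \<open>Splitting of T - C at distance M - k\<close>
  define fT where "fT = (\<lambda>d. \<mu> * cc \<alpha> (int d))"
  define fC where "fC = (\<lambda>d. \<mu> * strang_symbol \<alpha> M d)"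
  define fP where "fP = (\<lambda>d. if d < M - k then 0 else fT d - fC d)"
  define fQ where "fQ = (\<lambda>d. if d < M - k then fT d - fC d else 0)"
  note bij = assms(9)
  have T: "T = symtoep fT ix" unfolding assms(22) fT_def by (rule toeplitzT_eq_symtoep)
  have C: "C = symtoep fC ix" unfolding assms(23) fC_def by (rule strangC_eq_symtoep[OF bij])
  have split: "T - C = symtoep fP ix + symtoep fQ ix"
    by (simp add: T C symtoep_def vec_eq_iff fP_def fQ_def)
  have f0: "fT 0 = \<mu> * c0" "fC 0 = \<mu> * c0"
    using M8 by (simp_all add: fT_def fC_def strang_symbol_def c0(1))
  have sum_\<mu>cc: "(\<Sum>m\<in>{p..<q}. \<mu> * - cc \<alpha> (int m)) = \<mu> * (cc_tail \<alpha> p - cc_tail \<alpha> q)" if "1 \<le> p" "p \<le> q" for p q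
    unfolding sum_distrib_left[symmetric] sum_cc[OF \<alpha> that] ..
  have sumT: "(\<Sum>d\<in>{1..<M}. \<bar>fT d\<bar>) = \<mu> * (cc_tail \<alpha> 1 - cc_tail \<alpha> M)"
  proof -
    have "(\<Sum>d\<in>{1..<M}. \<bar>fT d\<bar>) = (\<Sum>d\<in>{1..<M}. \<mu> * - cc \<alpha> (int d))"
      by (rule sum.cong) (use \<mu> cc_neg[OF \<alpha>] in \<open>auto simp: fT_def abs_mult abs_of_neg\<close>)
    then show ?thesis using sum_\<mu>cc[of 1 M] M8 by linarith
  qed
  have sumC: "(\<Sum>d\<in>{1..<M}. \<bar>fC d\<bar>) = 2 * \<mu> * (cc_tail \<alpha> 1 - cc_tail \<alpha> (M div 2))"
    using sum_strang_symbol[OF \<alpha> M8(2)] M8 \<mu> by (simp add: fC_def abs_mult sum_distrib_left[symmetric])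
  have defect: "\<bar>fT d - fC d\<bar> \<le> \<mu> * - cc \<alpha> (int (M - d))" if "d < M" for d
    using mult_left_mono[OF strang_symbol_defect_le[OF \<alpha> that], of \<mu>] \<mu>
    by (simp add: fT_def fC_def right_diff_distrib[symmetric] abs_mult)
  \<comment> \<open>The substitution m = M - d turns the defects over distances p to q - 1 into
    coefficients with indices M - q + 1 to M - p.\<close>
  have defect_sum: "(\<Sum>d\<in>{p..<q}. \<bar>fT d - fC d\<bar>) \<le> \<mu> * (cc_tail \<alpha> (Suc (M - q)) - cc_tail \<alpha> (Suc (M - p)))"
    if "1 \<le> p" "p \<le> q" "q \<le> M" for p q
  proof -
    have "(\<Sum>d\<in>{p..<q}. \<bar>fT d - fC d\<bar>) \<le> (\<Sum>d\<in>{p..<q}. \<mu> * - cc \<alpha> (int (M - d)))"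
      using that by (intro sum_mono defect) auto
    also have "\<dots> = (\<Sum>m\<in>{Suc (M - q)..<Suc (M - p)}. \<mu> * - cc \<alpha> (int m))"
      by (rule sum.reindex_bij_witness[of _ "\<lambda>d. M - d" "\<lambda>d. M - d"]) (use that in auto)
    also have "\<dots> = \<mu> * (cc_tail \<alpha> (Suc (M - q)) - cc_tail \<alpha> (Suc (M - p)))"
      using that by (intro sum_\<mu>cc) auto
    finally show ?thesis .
  qed
  define p where "p = \<mu> * (c0 / 2 - \<theta> / (real M - 1/2) powr \<alpha>)"
  have sumP: "(\<Sum>d\<in>{1..<M}. \<bar>fP d\<bar>) \<le> p"
  proof -
    have "(\<Sum>d\<in>{1..<M}. \<bar>fP d\<bar>) = (\<Sum>d\<in>{M - k..<M}. \<bar>fP d\<bar>)"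
      by (rule sum.mono_neutral_right) (use k M8 in \<open>auto simp: fP_def\<close>)
    also have "\<dots> = (\<Sum>d\<in>{M - k..<M}. \<bar>fT d - fC d\<bar>)" by (rule sum.cong) (auto simp: fP_def)
    also have "\<dots> \<le> \<mu> * (cc_tail \<alpha> (Suc (M - M)) - cc_tail \<alpha> (Suc (M - (M - k))))"
      using k M8 by (intro defect_sum) auto
    also have "\<dots> = \<mu> * (c0 / 2 - cc_tail \<alpha> (Suc k))" using k c0(2) by simp
    also have "\<dots> \<le> p"
    proof -
      \<comment> \<open>Since k + 1 \<le> M - 1 \<le> M - 1/2, the tail at k + 1 dominates the
        subtracted term of the claimed bound.\<close>
      have "\<theta> / (real M - 1/2) powr \<alpha> \<le> cc_tail \<alpha> (M - 1)"
        using M8 by (intro tail_ge) (auto simp: of_nat_diff)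
      also have "\<dots> \<le> cc_tail \<alpha> (Suc k)" using k M8 by (intro cc_tail_antimono[OF \<alpha>]) auto
      finally show ?thesis unfolding p_def using \<mu> by (intro mult_left_mono) auto
    qed
    finally show ?thesis .
  qed
  have sumQ: "(\<Sum>d\<in>{1..<M}. \<bar>fQ d\<bar>) \<le> \<epsilon>"
  proof -
    have "(\<Sum>d\<in>{1..<M}. \<bar>fQ d\<bar>) = (\<Sum>d\<in>{1..<M - k}. \<bar>fQ d\<bar>)"
      by (rule sum.mono_neutral_right) (use k M8 in \<open>auto simp: fQ_def\<close>)
    also have "\<dots> = (\<Sum>d\<in>{1..<M - k}. \<bar>fT d - fC d\<bar>)" by (rule sum.cong) (auto simp: fQ_def)
    also have "\<dots> \<le> \<mu> * (cc_tail \<alpha> (Suc (M - (M - k))) - cc_tail \<alpha> (Suc (M - 1)))"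
      using k M8 by (intro defect_sum) auto
    also have "\<dots> \<le> \<mu> * cc_tail \<alpha> (Suc (M - (M - k)))"
      using cc_tail_pos[OF \<alpha>, of "Suc (M - 1)"] \<mu> by (intro mult_left_mono) auto
    also have "\<dots> \<le> \<epsilon>" using tail_k k by simp
    finally show ?thesis .
  qed
  have p0: "0 \<le> p" using sumP by (meson abs_ge_zero order_trans sum_nonneg)
  have norm_P: "norm (symtoep fP ix *v z) \<le> p * norm z" for z
  proof -
    have "norm (symtoep fP ix *v z) \<le> (\<Sum>d\<in>{1..<M}. \<bar>fP d\<bar>) * norm z"
      by (rule norm_symtoep_corner_le[OF bij]) (use M8 k in \<open>auto simp: fP_def\<close>)
    also have "\<dots> \<le> p * norm z" by (intro mult_right_mono sumP) auto
    finally show ?thesis .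
  qed
  have norm_Q: "norm (symtoep fQ ix *v z) \<le> \<epsilon> * norm z" for z
  proof -
    have "norm (symtoep fQ ix *v z) \<le> (\<Sum>d\<in>{1..<M}. \<bar>fQ d\<bar>) * norm z"
      \<comment> \<open>\<open>T\<close> and \<open>C\<close> agree at distances below M/2, so the
        remainder also lives in the corners.\<close>
      by (rule norm_symtoep_corner_le[OF bij]) (use M8 k in \<open>auto simp: fQ_def fT_def fC_def strang_symbol_def\<close>)
    also have "\<dots> \<le> \<epsilon> * norm z" by (intro mult_right_mono sumQ) auto
    finally show ?thesis .
  qed
  have rankP: "rank (blk (symtoep fP ix) 0 0 (symtoep fP ix)) = 4 * k"
  proof (rule rank_blk_symtoep_corner[OF bij k(3)])
    show "fP d = 0" if "d < M - k" for d using that by (simp add: fP_def)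
    show "fP (M - k) \<noteq> 0"
    \<comment> \<open>If k = M/2, the circulant has a zero there and \<mu> c_k remains. Otherwise
      strict monotonicity separates c_(M-k) from c_k.\<close>
    proof (cases "2 * k = M")
      case True
      then have "M - k = k" by simp
      then show ?thesis using True \<mu> cc_neg[OF \<alpha>, of k] k(2)
        by (simp add: fP_def fT_def fC_def strang_symbol_def)
    next
      case False
      then have "cc \<alpha> (int k) < cc \<alpha> (int (M - k))" using k by (intro cc_strict_mono[OF \<alpha>]) auto
      moreover have "strang_symbol \<alpha> M (M - k) = cc \<alpha> (int k)"
      proof -
        have "M - (M - k) = k" "\<not> 2 * (M - k) < M" "2 * (M - k) \<noteq> M" using False k by auto
        then show ?thesis by (simp only: strang_symbol_def if_False)
      qed
      ultimately show ?thesis using \<mu> by (simp add: fP_def fT_def fC_def)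
    qed
  qed

  \<comment> \<open>Spectral bounds and assembly\<close>
  define lT where "lT = \<omega> + 2 * g"
  define lC where "lC = \<omega> + 2 powr (\<alpha> + 1) * g"
  define L where "L = \<omega> + 2 * (\<mu> * c0 - g)"
  have c0pos: "0 \<le> \<mu> * c0" using c0(2) cc_tail_pos[OF \<alpha>, of 1] \<mu> by simp
  \<comment> \<open>The radius 2\<mu>(tail(1) - tail(M)) equals \<mu> c0 - 2\<mu> tail(M), and
    \<open>gT\<close> bounds the last tail. For \<open>C\<close> the tail is taken at M/2, which
    brings in the factor 2^\<alpha>.\<close>
  have domT: "norm (T *v z - (\<mu> * c0) *\<^sub>R z) \<le> (\<mu> * c0 - 2 * g) * norm z" for z
  proof -
    have "norm (T *v z - (\<mu> * c0) *\<^sub>R z) \<le> 2 * (\<Sum>d\<in>{1..<M}. \<bar>fT d\<bar>) * norm z"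
      using symtoep_diag_dominance[OF bij, of fT z] by (simp add: T f0)
    also have "\<dots> \<le> (\<mu> * c0 - 2 * g) * norm z"
      using gT unfolding sumT c0(2) by (intro mult_right_mono) (auto simp: algebra_simps)
    finally show ?thesis .
  qed
  have domC: "norm (C *v z - (\<mu> * c0) *\<^sub>R z) \<le> (\<mu> * c0 - 2 powr (\<alpha> + 1) * g) * norm z" for z
  proof -
    have per: "fC (M - d) = fC d" if "0 < d" "d < M" for d
      using that by (auto simp: fC_def strang_symbol_def)
    have "norm (C *v z - (\<mu> * c0) *\<^sub>R z) \<le> (\<Sum>d\<in>{1..<M}. \<bar>fC d\<bar>) * norm z"
      using circulant_diag_dominance[of ix M fC z, OF bij per] by (simp add: C f0)
    also have "\<dots> \<le> (\<mu> * c0 - 2 powr (\<alpha> + 1) * g) * norm z"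
      using gC unfolding sumC c0(2) by (intro mult_right_mono) (auto simp: algebra_simps powr_add)
    finally show ?thesis .
  qed
  note bT = norm_shifted_bounds[OF less_imp_le[OF assms(14)] c0pos domT]
  note bC = norm_shifted_bounds[OF less_imp_le[OF assms(14)] c0pos domC]
  have posT: "z \<bullet> (T *v z) > 0" if "z \<noteq> 0" for z
  proof -
    have "0 < 2 * g * (z \<bullet> z)" using g that by simp
    then show ?thesis using bT(4)[of z] by simp
  qed
  have L0: "0 \<le> L"
  proof -
    have "g \<le> \<mu> * cc_tail \<alpha> M" by (rule gT)
    also have "\<dots> \<le> \<mu> * cc_tail \<alpha> 1" using \<mu> M8 by (intro mult_left_mono cc_tail_antimono[OF \<alpha>]) auto
    also have "\<dots> \<le> \<mu> * c0" unfolding c0(2) using \<mu> cc_tail_pos[OF \<alpha>, of 1] by (intro mult_left_mono) auto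
    finally show ?thesis using assms(14) by (simp add: L_def)
  qed
  define X where "X = 2 * sqrt (1 + L\<^sup>2) / (sqrt (1 + lC\<^sup>2) * sqrt (1 + lT\<^sup>2))"
  have X0: "0 \<le> X" by (simp add: X_def)
  have "\<xi> = sqrt (real M) * X"
  proof -
    have "\<omega> + 2 * (Gamma (\<alpha> + 1) * \<mu> / Gamma (\<alpha>/2 + 1)^2 - \<theta> * \<gamma> * \<tau> / (b - a) powr \<alpha>) = L"
      "\<omega> + 2 powr (\<alpha> + 1) * \<gamma> * \<tau> * \<theta> / (b - a) powr \<alpha> = lC"
      "\<omega> + 2 * \<gamma> * \<tau> * \<theta> / (b - a) powr \<alpha> = lT"
      by (simp_all add: L_def lC_def lT_def g_def assms(19) mult_ac)
    then show ?thesis unfolding assms(20) X_def by simp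
  qed
  \<comment> \<open>Passing from \<open>X\<close> to \<xi> uses sqrt M \<ge> 1.\<close>
  moreover have "1 * X \<le> sqrt (real M) * X" using M8 X0 by (intro mult_right_mono) auto
  ultimately have X\<xi>: "X \<le> \<xi>" by simp
  have "\<exists>Mw Nw :: real^('n + 'n)^('n + 'n). rank Mw = rank (blk (symtoep fP ix) 0 0 (symtoep fP ix))
     \<and> specnorm Mw \<le> X * p \<and> specnorm Nw \<le> X * \<epsilon>
     \<and> matrix_inv Ft ** \<R> = matrix_inv F ** \<R> + Mw + Nw"
  proof (rule preconditioner_perturbation[where T = T and C = C and D = D and Q = "symtoep fQ ix"
        and lT = lT and lC = lC and L = L and \<omega> = \<omega>])
    show "0 \<le> lT" "0 \<le> lC" using g assms(14) by (simp_all add: lT_def lC_def)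
    show "lT * norm z \<le> norm ((\<omega> *\<^sub>R mat 1 + T) *v z)" for z using bT(1)[of z] by (simp add: lT_def)
    show "lC * norm z \<le> norm ((\<omega> *\<^sub>R mat 1 + C) *v z)" for z using bC(1)[of z] by (simp add: lC_def)
    show "norm ((\<omega> *\<^sub>R mat 1 + T) *v z) \<le> L * norm z" for z using bT(2)[of z] by (simp add: L_def algebra_simps)
    show "norm ((\<omega> *\<^sub>R mat 1 - T) *v z) \<le> L * norm z" for z using bT(3)[of z] by (simp add: L_def algebra_simps)
    show "T $ i $ j = T $ j $ i" "C $ i $ j = C $ j $ i" for i j unfolding T C by (rule symtoep_sym)+
  qed (use assms(12-14) posT L0 split p0 \<epsilon> norm_P norm_Q assms(24-29) X_def in auto)
  then obtain Mw Nw :: "real^('n + 'n)^('n + 'n)" where w: "rank Mw = 4 * k"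
     "specnorm Mw \<le> X * p" "specnorm Nw \<le> X * \<epsilon>"
     "matrix_inv Ft ** \<R> = matrix_inv F ** \<R> + Mw + Nw"
    unfolding rankP by blast
  have "X * p \<le> \<xi> * p" "X * \<epsilon> \<le> \<xi> * \<epsilon>" using X\<xi> p0 \<epsilon> by (auto intro: mult_right_mono)
  then have "specnorm Mw \<le> \<mu> * \<xi> * (c0 / 2 - \<theta> / (real M - 1/2) powr \<alpha>)" "specnorm Nw \<le> \<xi> * \<epsilon>"
    using w by (auto simp: p_def mult_ac)
  moreover have "int (rank Mw) = 4 * k0" using w(1) k(1) by simp
  ultimately show ?thesis using w(4) by blast
qed

end
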